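(* Let $G\not\equiv0$ be an infinitesimal generator in $\mathbb{D}$ with Denjoy-Wolff point $\tau\in\overline{\mathbb{D}}$, whose associated semigroup $(\phi_t)_{t\ge0}$ is not a group of elliptic automorphisms of $\mathbb{D}$. Let $h$ be the associated K\"onigs function. Let $x\in\partial\mathbb{D}\setminus\{\tau\}$. The following are equivalent: (1) $\liminf_{(0,1)\ni r\to1}|G(rx)|/(1-r)<+\infty$; (2) $x$ is a boundary regular null point for $G$; (3) $x$ is a boundary regular fixed point for $\phi_t$ for some (equivalently, for any) $t>0$; (4) there exists $\rho>0$ such that $$\lim_{(0,1)\ni r\to1}\frac{\log|h(rx)|}{\mathrm{Re}\,G'(\tau)\,\log(1-r)}=\rho\ \text{ if }\tau\in\mathbb{D},\qquad \lim_{(0,1)\ni r\to1}\frac{\mathrm{Re}\,h(rx)}{\log(1-r)}=\rho\ \text{ if }\tau\in\partial\mathbb{D};$$ (5) $$\limsup_{(0,1)\ni r\to1}\frac{|h'(rx)|(1-r)}{|h(rx)|}>0\ \text{ if }\tau\in\mathbb{D},\qquad \limsup_{(0,1)\ni r\to1}|h'(rx)|(1-r)>0\ \text{ if }\tau\in\partial\mathbb{D}.$$ Moreover, if these conditions are satisfied and $\ell:=\lim_{r\to1}|G(rx)|/(1-r)>0$, then $\angle\lim_{z\to x}|h(z)|=\infty$, the number $\rho$ in (4) satisfies $\rho^{-1}=\ell$, and (a1) $\angle\lim_{z\to x}\frac{h'(z)(z-x)}{h(z)}=\frac{G'(\tau)}{\ell}$ if $\tau\in\mathbb{D}$; (a2)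 $\angle\lim_{z\to x}h'(z)(z-x)=\frac1\ell$ if $\tau\in\partial\mathbb{D}$.
   Context: $\mathbb{D}$ is the open unit disc in $\mathbb{C}$. A semigroup $(\phi_t)_{t\ge0}$ of holomorphic self-maps of $\mathbb{D}$ is a family of holomorphic maps $\phi_t:\mathbb{D}\to\mathbb{D}$ with $\phi_0=\mathrm{id}$, $\phi_{t+s}=\phi_t\circ\phi_s$, and $t\mapsto\phi_t$ continuous for uniform convergence on compacta. Its infinitesimal generator is the unique holomorphic $G:\mathbb{D}\to\mathbb{C}$ with $\partial_t\phi_t(z)=G(\phi_t(z))$ for all $t\ge 0$, $z\in\mathbb D$; an infinitesimal generator in $\mathbb D$ is a $G$ arising this way. Berkson-Porta formula: if $G\not\equiv0$ there are a unique $\tau\in\overline{\mathbb{D}}$ (the Denjoy-Wolff point) and a unique holomorphic $p:\mathbb{D}\to\mathbb{C}$ with $\mathrm{Re}\,p\ge0$ such that $G(z)=(z-\tau)(\overline{\tau}z-1)p(z)$. K\"onigs function $h$ associated with $G\not\equiv 0$: the unique univalent $h:\mathbb{D}\to\mathbb{C}$ such that: if $\tau\in\mathbb{D}$, then $h(\tau)=0$, $h'(\tau)=1$ and $h'(z)G(z)=G'(\tau)h(z)$ for all $z\in\mathbb D$ (so $h\circ\phi_t=e^{G'(\tau)t}h$); if $\tau\in\partial\mathbb{D}$, then $h(0)=0$ and $h'(z)G(z)=1$ for all $z\in\mathbb D$ (so $h\circ\phi_t=h+t$). $\angle\lim$ denotes non-tangential limit, i.e. the limit as $z\to x$ inside Stolz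 angles $\{z\in\mathbb{D}:|x-z|<R(1-|z|)\}$, $R>1$. A boundary regular null point for $G$ is a point $x\in\partial\mathbb{D}$ such that $\angle\lim_{z\to x}\frac{G(z)}{z-x}\in\mathbb{R}$ exists and is finite. A boundary regular fixed point of a holomorphic $f:\mathbb{D}\to\mathbb{D}$ is a point $x\in\partial\mathbb{D}$ with $\angle\lim_{z\to x}f(z)=x$ and $\liminf_{z\to x}\frac{1-|f(z)|}{1-|z|}<+\infty$. A group of elliptic automorphisms is a semigroup each of whose elements is an automorphism of $\mathbb{D}$ fixing a common point $\tau\in\mathbb{D}$. *)

theory Defs
  imports "HOL-Complex_Analysis.Complex_Analysis"
begin

abbreviation unit_disc :: "complex set" where
  "unit_disc \<equiv> ball 0 1"

(* Only the values \<phi> t z with t \<ge> 0 and z in the disc matter. *)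
definition disc_semigroup :: "(real \<Rightarrow> complex \<Rightarrow> complex) \<Rightarrow> bool" where
  "disc_semigroup \<phi> \<longleftrightarrow>
     (\<forall>t\<ge>0. \<phi> t holomorphic_on unit_disc \<and> \<phi> t ` unit_disc \<subseteq> unit_disc) \<and>
     (\<forall>z\<in>unit_disc. \<phi> 0 z = z) \<and>
     (\<forall>t\<ge>0. \<forall>s\<ge>0. \<forall>z\<in>unit_disc. \<phi> (t + s) z = \<phi> t (\<phi> s z)) \<and>
     (\<forall>K. compact K \<and> K \<subseteq> unit_disc \<longrightarrow>
        (\<forall>t\<ge>0. uniform_limit K \<phi> (\<phi> t) (at t within {0..})))"

definition generator_of :: "(real \<Rightarrow> complex \<Rightarrow> complex) \<Rightarrow> (complex \<Rightarrow> complex) \<Rightarrow> bool" where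
  "generator_of \<phi> G \<longleftrightarrow>
     G holomorphic_on unit_disc \<and>
     (\<forall>t\<ge>0. \<forall>z\<in>unit_disc.
        ((\<lambda>s. \<phi> s z) has_vector_derivative G (\<phi> t z)) (at t within {0..}))"

definition disc_automorphism :: "(complex \<Rightarrow> complex) \<Rightarrow> bool" where
  "disc_automorphism f \<longleftrightarrow>
     f holomorphic_on unit_disc \<and> f ` unit_disc \<subseteq> unit_disc \<and>
     (\<exists>g. g holomorphic_on unit_disc \<and> g ` unit_disc \<subseteq> unit_disc \<and>
        (\<forall>z\<in>unit_disc. g (f z) = z \<and> f (g z) = z))"

definition elliptic_group :: "(real \<Rightarrow> complex \<Rightarrow> complex) \<Rightarrow> bool" where
  "elliptic_group \<phi> \<longleftrightarrow>
     disc_semigroup \<phi> \<and>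
     (\<exists>\<sigma>\<in>unit_disc. \<forall>t\<ge>0. disc_automorphism (\<phi> t) \<and> \<phi> t \<sigma> = \<sigma>)"

(* The point \<tau> in the Berkson-Porta representation of G; it is unique when G is not
   identically zero on the disc. *)
definition denjoy_wolff_point :: "(complex \<Rightarrow> complex) \<Rightarrow> complex \<Rightarrow> bool" where
  "denjoy_wolff_point G \<tau> \<longleftrightarrow>
     \<tau> \<in> cball 0 1 \<and>
     (\<exists>p. p holomorphic_on unit_disc \<and> (\<forall>z\<in>unit_disc. Re (p z) \<ge> 0) \<and>
        (\<forall>z\<in>unit_disc. G z = (z - \<tau>) * (cnj \<tau> * z - 1) * p z))"

definition koenigs_function ::
  "(complex \<Rightarrow> complex) \<Rightarrow> complex \<Rightarrow> (complex \<Rightarrow> complex) \<Rightarrow> bool" where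
  "koenigs_function G \<tau> h \<longleftrightarrow>
     h holomorphic_on unit_disc \<and> inj_on h unit_disc \<and>
     (if \<tau> \<in> unit_disc
      then h \<tau> = 0 \<and> deriv h \<tau> = 1 \<and>
           (\<forall>z\<in>unit_disc. deriv h z * G z = deriv G \<tau> * h z)
      else h 0 = 0 \<and> (\<forall>z\<in>unit_disc. deriv h z * G z = 1))"

definition stolz_angle :: "complex \<Rightarrow> real \<Rightarrow> complex set" where
  "stolz_angle x R = {z \<in> unit_disc. cmod (x - z) < R * (1 - cmod z)}"

(* Non-tangential convergence of f at x along the target filter F: take F = nhds L for a
   finite limit L and F = at_top for the limit infinity of a real-valued f. *)
definition angular_lim :: "(complex \<Rightarrow> 'b) \<Rightarrow> 'b filter \<Rightarrow> complex \<Rightarrow> bool" where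
  "angular_lim f F x \<longleftrightarrow> (\<forall>R>1. filterlim f F (at x within stolz_angle x R))"

definition boundary_regular_null_point :: "(complex \<Rightarrow> complex) \<Rightarrow> complex \<Rightarrow> bool" where
  "boundary_regular_null_point G x \<longleftrightarrow>
     x \<in> sphere 0 1 \<and>
     (\<exists>l::real. angular_lim (\<lambda>z. G z / (z - x)) (nhds (complex_of_real l)) x)"

definition boundary_regular_fixed_point :: "(complex \<Rightarrow> complex) \<Rightarrow> complex \<Rightarrow> bool" where
  "boundary_regular_fixed_point f x \<longleftrightarrow>
     x \<in> sphere 0 1 \<and> angular_lim f (nhds x) x \<and>
     Liminf (at x within unit_disc) (\<lambda>z. ereal ((1 - cmod (f z)) / (1 - cmod z))) < \<infinity>"

definition koenigs_radial_growth ::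
  "(complex \<Rightarrow> complex) \<Rightarrow> complex \<Rightarrow> (complex \<Rightarrow> complex) \<Rightarrow> complex \<Rightarrow> real \<Rightarrow> bool" where
  "koenigs_radial_growth G \<tau> h x \<rho> \<longleftrightarrow>
     (if \<tau> \<in> unit_disc
      then ((\<lambda>r. ln (cmod (h (of_real r * x))) / (Re (deriv G \<tau>) * ln (1 - r))) \<longlongrightarrow> \<rho>)
             (at_left 1)
      else ((\<lambda>r. Re (h (of_real r * x)) / ln (1 - r)) \<longlongrightarrow> \<rho>) (at_left 1))"

end

theory Submission
  imports Defs
begin

text \<open>
  In the Berkson-Porta formula \<open>G z = (z - \<tau>) (cnj \<tau> z - 1) p z\<close> the function \<open>p\<close> has no zero, so
  \<open>q = 1 / p\<close> maps the disc into the closed right half-plane. By the Julia-Wolff theorem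
  \<open>(z - x) q z\<close> has the angular limit \<open>- 2 c x\<close> at \<open>x\<close>, where
  \<open>c = inf (Re q z / Re ((x + z) / (x - z))) \<ge> 0\<close>; hence \<open>(z - x) / G z\<close> tends angularly to
  \<open>m = 2 c / |x - \<tau>|\<^sup>2\<close>. The limit always exists, and every condition says that \<open>m > 0\<close>.
  For (1), (2), (5) this is immediate from \<open>h' / h = G' \<tau> / G\<close> or \<open>h' = 1 / G\<close>, and for (4) it is
  l'Hopital's rule. If \<open>c > 0\<close>, then \<open>Re q z \<ge> c Re ((x + z) / (x - z))\<close> gives a differential
  inequality for \<open>Re ((x + \<phi> t z) / (x - \<phi> t z))\<close>, from which (3) follows for all \<open>t\<close>. If \<open>c = 0\<close> and
  \<open>x\<close> were a boundary regular fixed point of \<open>\<phi> t\<close>, then \<open>r x\<close> and \<open>\<phi> t (r x)\<close> would stay at bounded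
  hyperbolic distance while \<open>(z - x) h' z\<close> (or \<open>(z - x) h' z / h z\<close>) tends to \<open>0\<close>, so \<open>h\<close> (or \<open>log h\<close>)
  would take asymptotically equal values at the two points, contradicting
  \<open>h (\<phi> t z) = h z + t\<close> (or \<open>h (\<phi> t z) = exp (G' \<tau> t) h z\<close> with \<open>Re (G' \<tau>) < 0\<close>).
\<close>

section \<open>Schwarz-Pick inequalities\<close>

text \<open>Together with \<open>norm_cross_half_plane\<close> this relates numerator and
  denominator of a pseudo-hyperbolic distance. It puts the Schwarz-Pick inequalities into a product
  form in which the defects 1 - |a|^2 and 1 - |z|^2 are visible.\<close>

lemma norm_cross_disc:
  "(cmod (1 - cnj a * z))\<^sup>2 = (cmod (z - a))\<^sup>2 + (1 - (cmod a)\<^sup>2) * (1 - (cmod z)\<^sup>2)"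
  unfolding cmod_power2 by (simp add: power2_eq_square algebra_simps)

lemma norm_cross_half_plane:
  "(cmod (a + cnj b))\<^sup>2 = (cmod (a - b))\<^sup>2 + 4 * Re a * Re b"
  unfolding cmod_power2 by (simp add: power2_eq_square algebra_simps)

lemma disc_norm_sq_pos: "z \<in> unit_disc \<Longrightarrow> 0 < 1 - (cmod z)\<^sup>2"
  by (simp add: power_less_one_iff)

lemma disc_cross_nonzero:
  assumes "a \<in> cball 0 1" "z \<in> unit_disc"
  shows "1 - cnj a * z \<noteq> 0"
proof
  assume "1 - cnj a * z = 0"
  then have "cmod (cnj a * z) = 1" by simp
  moreover have "cmod (cnj a * z) \<le> cmod z"
    using assms by (simp add: norm_mult mult_left_le_one_le)
  ultimately show False using assms by simp
qed

text \<open>The Schwarz lemma at 0, moved to \<open>a\<close> by a Moebius map. Squaring and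
  clearing denominators prepares for \<open>norm_cross_disc\<close>.\<close>

lemma schwarz_lemma_at:
  assumes F: "F holomorphic_on unit_disc" "F ` unit_disc \<subseteq> unit_disc"
    and a: "a \<in> unit_disc" "F a = 0" and z: "z \<in> unit_disc"
  shows "(cmod (F z))\<^sup>2 * (cmod (1 - cnj a * z))\<^sup>2 \<le> (cmod (z - a))\<^sup>2"
proof -
  define M where "M = Moebius_function 0 (-a)"
  define w where "w = Moebius_function 0 a z"
  have M: "M holomorphic_on unit_disc" "M ` unit_disc \<subseteq> unit_disc"
    unfolding M_def using a Moebius_function_holomorphic Moebius_function_norm_lt_1 by auto
  have w: "w \<in> unit_disc"
    unfolding w_def using a z Moebius_function_norm_lt_1 by auto
  have Mw: "M w = z"
    unfolding M_def w_def using Moebius_function_compose[of "-a" a z] a z by simp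
  have "cmod ((F \<circ> M) w) \<le> cmod w"
  proof (rule Schwarz_Lemma(1))
    show "(F \<circ> M) holomorphic_on ball 0 1"
      using holomorphic_on_compose_gen[OF M(1) F(1) M(2)] .
    show "(F \<circ> M) 0 = 0"
      using a by (simp add: M_def Moebius_function_of_zero)
    show "cmod ((F \<circ> M) \<zeta>) < 1" if "cmod \<zeta> < 1" for \<zeta>
      using M(2) F(2) that by force
    show "cmod w < 1" using w by simp
  qed
  then have "cmod (F z) \<le> cmod (z - a) / cmod (1 - cnj a * z)"
    by (simp add: Mw) (simp add: w_def Moebius_function_simple norm_divide)
  moreover have "cmod (1 - cnj a * z) > 0"
    using disc_cross_nonzero[of a z] a z by simp
  ultimately have "cmod (F z) * cmod (1 - cnj a * z) \<le> cmod (z - a)"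
    by (simp add: pos_le_divide_eq)
  then have "(cmod (F z) * cmod (1 - cnj a * z))\<^sup>2 \<le> (cmod (z - a))\<^sup>2"
    by (intro power_mono) auto
  then show ?thesis by (simp add: power_mult_distrib)
qed

text \<open>Obtained from \<open>schwarz_lemma_at\<close> for \<open>f\<close> followed by the
  Moebius map that sends \<open>f a\<close> to 0. The product form can be divided by 1 - |a|^2
  before \<open>a\<close> is sent to the circle, which is how Julia's lemma arises below.\<close>

lemma schwarz_pick_disc:
  assumes f: "f holomorphic_on unit_disc" "f ` unit_disc \<subseteq> unit_disc"
    and a: "a \<in> unit_disc" and z: "z \<in> unit_disc"
  shows "(cmod (1 - cnj (f a) * f z))\<^sup>2 * ((1 - (cmod a)\<^sup>2) * (1 - (cmod z)\<^sup>2))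
    \<le> (cmod (1 - cnj a * z))\<^sup>2 * ((1 - (cmod (f a))\<^sup>2) * (1 - (cmod (f z))\<^sup>2))"
proof -
  define M where "M = Moebius_function 0 (f a)"
  have fa: "f a \<in> unit_disc" and fz: "f z \<in> unit_disc" using f(2) a z by blast+
  have M: "M holomorphic_on unit_disc" "M ` unit_disc \<subseteq> unit_disc"
    unfolding M_def using fa Moebius_function_holomorphic Moebius_function_norm_lt_1 by auto
  have "(cmod ((M \<circ> f) z))\<^sup>2 * (cmod (1 - cnj a * z))\<^sup>2 \<le> (cmod (z - a))\<^sup>2"
  proof (rule schwarz_lemma_at)
    show "(M \<circ> f) holomorphic_on unit_disc"
      by (rule holomorphic_on_compose_gen[OF f(1) M(1) f(2)])
    show "(M \<circ> f) ` unit_disc \<subseteq> unit_disc" using M(2) f(2) by force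
    show "(M \<circ> f) a = 0" by (simp add: M_def Moebius_function_eq_zero)
  qed (use a z in auto)
  moreover have "(cmod ((M \<circ> f) z))\<^sup>2 = (cmod (f z - f a))\<^sup>2 / (cmod (1 - cnj (f a) * f z))\<^sup>2"
    by (simp add: M_def Moebius_function_simple norm_divide power_divide)
  moreover have "(cmod (1 - cnj (f a) * f z))\<^sup>2 > 0"
    using disc_cross_nonzero[of "f a" "f z"] fa fz by simp
  ultimately have "(cmod (f z - f a))\<^sup>2 * (cmod (1 - cnj a * z))\<^sup>2
      \<le> (cmod (z - a))\<^sup>2 * (cmod (1 - cnj (f a) * f z))\<^sup>2"
    by (simp add: field_simps)
  then show ?thesis
    unfolding norm_cross_disc[of a z] norm_cross_disc[of "f a" "f z"]
    by (simp add: algebra_simps)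
qed

text \<open>The Cayley map in \<open>F\<close> sends the right half-plane to the disc and
  \<open>p a\<close> to 0. Strict positivity keeps its denominator away from 0 and gives |F| <
  1.\<close>

lemma schwarz_pick_half_plane_pos:
  assumes p: "p holomorphic_on unit_disc" "\<And>z. z \<in> unit_disc \<Longrightarrow> Re (p z) > 0"
    and a: "a \<in> unit_disc" and z: "z \<in> unit_disc"
  shows "(cmod (p z - p a))\<^sup>2 * ((1 - (cmod a)\<^sup>2) * (1 - (cmod z)\<^sup>2))
    \<le> 4 * Re (p z) * Re (p a) * (cmod (z - a))\<^sup>2"
proof -
  define F where "F = (\<lambda>z. (p z - p a) / (p z + cnj (p a)))"
  have ne: "p \<zeta> + cnj (p a) \<noteq> 0" if "\<zeta> \<in> unit_disc" for \<zeta>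
    using p(2)[OF that] p(2)[OF a] by (auto simp: complex_eq_iff)
  have "cmod (F \<zeta>) < 1" if "\<zeta> \<in> unit_disc" for \<zeta>
  proof -
    have "(cmod (p \<zeta> - p a))\<^sup>2 < (cmod (p \<zeta> + cnj (p a)))\<^sup>2"
      using norm_cross_half_plane[of "p \<zeta>" "p a"] p(2)[OF that] p(2)[OF a] by simp
    then have "cmod (p \<zeta> - p a) < cmod (p \<zeta> + cnj (p a))"
      by (rule power_less_imp_less_base) simp
    then show ?thesis using ne[OF that] by (simp add: F_def norm_divide)
  qed
  then have "(cmod (F z))\<^sup>2 * (cmod (1 - cnj a * z))\<^sup>2 \<le> (cmod (z - a))\<^sup>2"
    using ne a z by (intro schwarz_lemma_at) (auto simp: F_def intro!: holomorphic_intros p(1))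
  moreover have "(cmod (F z))\<^sup>2 = (cmod (p z - p a))\<^sup>2 / (cmod (p z + cnj (p a)))\<^sup>2"
    by (simp add: F_def norm_divide power_divide)
  moreover have "(cmod (p z + cnj (p a)))\<^sup>2 > 0" using ne[OF z] by simp
  ultimately have "(cmod (p z - p a))\<^sup>2 * (cmod (1 - cnj a * z))\<^sup>2
      \<le> (cmod (z - a))\<^sup>2 * (cmod (p z + cnj (p a)))\<^sup>2"
    by (simp add: field_simps)
  then show ?thesis
    unfolding norm_cross_disc[of a z] norm_cross_half_plane[of "p z" "p a"]
    by (simp add: algebra_simps)
qed

text \<open>The strict case applies to \<open>p\<close> plus any positive constant \<epsilon>; then
  \<epsilon> tends to 0.\<close>

lemma schwarz_pick_half_plane:
  assumes p: "p holomorphic_on unit_disc" "\<And>z. z \<in> unit_disc \<Longrightarrow> Re (p z) \<ge> 0"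
    and a: "a \<in> unit_disc" and z: "z \<in> unit_disc"
  shows "(cmod (p z - p a))\<^sup>2 * ((1 - (cmod a)\<^sup>2) * (1 - (cmod z)\<^sup>2))
    \<le> 4 * Re (p z) * Re (p a) * (cmod (z - a))\<^sup>2"
proof (rule tendsto_lowerbound)
  let ?R = "\<lambda>\<epsilon>. 4 * (Re (p z) + \<epsilon>) * (Re (p a) + \<epsilon>) * (cmod (z - a))\<^sup>2"
  have "((\<lambda>\<epsilon>. ?R \<epsilon>) \<longlongrightarrow> ?R 0) (at_right 0)" by (intro tendsto_intros)
  then show "(?R \<longlongrightarrow> 4 * Re (p z) * Re (p a) * (cmod (z - a))\<^sup>2) (at_right 0)" by simp
  show "\<forall>\<^sub>F \<epsilon> in at_right 0. (cmod (p z - p a))\<^sup>2 * ((1 - (cmod a)\<^sup>2) * (1 - (cmod z)\<^sup>2)) \<le> ?R \<epsilon>"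
    using eventually_at_right_less
  proof eventually_elim
    case (elim \<epsilon>)
    have "(cmod ((p z + of_real \<epsilon>) - (p a + of_real \<epsilon>)))\<^sup>2 * ((1 - (cmod a)\<^sup>2) * (1 - (cmod z)\<^sup>2))
      \<le> 4 * Re (p z + of_real \<epsilon>) * Re (p a + of_real \<epsilon>) * (cmod (z - a))\<^sup>2"
      using p elim a z
      by (intro schwarz_pick_half_plane_pos[where p = "\<lambda>z. p z + of_real \<epsilon>"])
         (auto intro!: holomorphic_intros add_nonneg_pos)
    then show ?case by simp
  qed
qed simp

text \<open>The right side of Schwarz-Pick contains the factor \<open>Re (p a)\<close> and vanishes.
  This serves as the minimum principle for \<open>Re p\<close>.\<close>

lemma nonneg_Re_eq_constant:
  assumes p: "p holomorphic_on unit_disc" "\<And>z. z \<in> unit_disc \<Longrightarrow> Re (p z) \<ge> 0"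
    and a: "a \<in> unit_disc" "Re (p a) = 0" and z: "z \<in> unit_disc"
  shows "p z = p a"
proof -
  have "(cmod (p z - p a))\<^sup>2 * ((1 - (cmod a)\<^sup>2) * (1 - (cmod z)\<^sup>2)) \<le> 0"
    using schwarz_pick_half_plane[OF p a(1) z] a(2) by simp
  moreover have "(1 - (cmod a)\<^sup>2) * (1 - (cmod z)\<^sup>2) > 0"
    using disc_norm_sq_pos a z by simp
  ultimately have "(cmod (p z - p a))\<^sup>2 \<le> 0"
    by (meson mult_le_0_iff not_le)
  then show ?thesis by simp
qed

section \<open>The Julia-Wolff theorem for the half-plane\<close>

text \<open>The right side is the Poisson kernel with pole \<open>x\<close>; its superlevel sets are
  the horodiscs at \<open>x\<close>.\<close>

lemma Re_cayley:
  assumes "x \<in> sphere 0 1"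
  shows "Re ((x + z) / (x - z)) = (1 - (cmod z)\<^sup>2) / (cmod (x - z))\<^sup>2"
proof -
  have "(x + z) / (x - z) = (x + z) * cnj (x - z) / of_real ((cmod (x - z))\<^sup>2)"
    by (metis complex_div_cnj of_real_power)
  then have "Re ((x + z) / (x - z)) = Re ((x + z) * cnj (x - z)) / (cmod (x - z))\<^sup>2"
    by simp
  moreover have "Re ((x + z) * cnj (x - z)) = (cmod x)\<^sup>2 - (cmod z)\<^sup>2"
    unfolding cmod_power2 by (simp add: power2_eq_square algebra_simps)
  ultimately show ?thesis using assms by simp
qed

lemma sphere_ne_disc: "x \<in> sphere 0 1 \<Longrightarrow> z \<in> unit_disc \<Longrightarrow> x \<noteq> (z::complex)"
  by auto

lemma Re_cayley_pos:
  assumes "x \<in> sphere 0 1" "z \<in> unit_disc"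
  shows "Re ((x + z) / (x - z)) > 0"
  using disc_norm_sq_pos[OF assms(2)] sphere_ne_disc[OF assms] by (simp add: Re_cayley[OF assms(1)])

lemma eventually_mem_within: "\<forall>\<^sub>F z in at x within S. z \<in> S"
  by (simp add: eventually_at_filter)

lemma filterlim_radial_stolz:
  assumes x: "x \<in> sphere 0 1" and R: "R > 1"
  shows "filterlim (\<lambda>r. of_real r * x) (at x within stolz_angle x R) (at_left 1)"
proof -
  have "((\<lambda>r. complex_of_real r * x) \<longlongrightarrow> of_real 1 * x) (at_left 1)"
    by (intro tendsto_intros)
  moreover have "\<forall>\<^sub>F r in at_left (1::real). of_real r * x \<in> stolz_angle x R \<and> of_real r * x \<noteq> x"
    using eventually_at_left_real[of 0 1]
  proof (rule eventually_mono)
    show "0 < (1::real)" by simp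
    fix r :: real assume r: "r \<in> {0<..<1}"
    have "x - of_real r * x = of_real (1 - r) * x" by (simp add: algebra_simps)
    then have "cmod (x - of_real r * x) = 1 - r"
      using r x by (simp add: norm_mult del: of_real_diff)
    moreover have "cmod (of_real r * x) = r"
      using r x by (simp add: norm_mult)
    moreover have "1 - r < R * (1 - r)" using r R by simp
    ultimately show "of_real r * x \<in> stolz_angle x R \<and> of_real r * x \<noteq> x"
      using r x by (auto simp: stolz_angle_def)
  qed
  ultimately show ?thesis by (simp add: filterlim_at eventually_conj_iff)
qed

lemma angular_lim_radial:
  assumes "angular_lim f F x" "x \<in> sphere 0 1"
  shows "filterlim (\<lambda>r. f (of_real r * x)) F (at_left 1)"
  using filterlim_compose[OF _ filterlim_radial_stolz[OF assms(2), of 2], of f F] assms(1)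
  by (simp add: angular_lim_def)

text \<open>The case of vanishing angular derivative: one point \<open>a\<close> with small ratio controls the whole
  Stolz angle through the Schwarz-Pick inequality based at \<open>a\<close>.\<close>

lemma angular_lim_julia_wolff_zero:
  assumes q: "q holomorphic_on unit_disc" "\<And>z. z \<in> unit_disc \<Longrightarrow> Re (q z) \<ge> 0"
    and x: "x \<in> sphere 0 1"
    and small: "\<And>\<epsilon>. \<epsilon> > 0 \<Longrightarrow> \<exists>a\<in>unit_disc. Re (q a) < \<epsilon> * Re ((x + a) / (x - a))"
  shows "angular_lim (\<lambda>z. (z - x) * q z) (nhds 0) x"
  unfolding angular_lim_def
proof (intro allI impI tendstoI)
  fix R e :: real assume R: "R > 1" and e: "e > 0"
  \<comment> \<open>Makes the constant \<open>R * (8 * \<epsilon>)\<close> of the quadratic estimate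
    below equal to \<open>e / 8\<close>.\<close>
  define \<epsilon> where "\<epsilon> = e / (64 * R)"
  have \<epsilon>: "\<epsilon> > 0" using R e by (simp add: \<epsilon>_def)
  obtain a where a: "a \<in> unit_disc" and qa: "Re (q a) < \<epsilon> * Re ((x + a) / (x - a))"
    using small[OF \<epsilon>] by blast
  let ?F = "at x within stolz_angle x R"
  have xa: "cmod (x - a) > 0" using a x by auto
  have "((\<lambda>z. (cmod (z - a))\<^sup>2) \<longlongrightarrow> (cmod (x - a))\<^sup>2) ?F"
    by (intro tendsto_intros)
  then have E1: "\<forall>\<^sub>F z in ?F. (cmod (z - a))\<^sup>2 < 2 * (cmod (x - a))\<^sup>2"
    using xa by (intro order_tendstoD(2)) auto
  have "((\<lambda>z. cmod (q a) * cmod (z - x)) \<longlongrightarrow> cmod (q a) * cmod (x - x)) ?F"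
    by (intro tendsto_intros)
  then have E2: "\<forall>\<^sub>F z in ?F. cmod (q a) * cmod (z - x) < e / 4"
    using e by (intro order_tendstoD(2)) auto
  show "\<forall>\<^sub>F z in ?F. dist ((z - x) * q z) 0 < e"
    using E1 E2 eventually_mem_within
  proof eventually_elim
    case (elim z)
    have z: "z \<in> unit_disc" and zR: "cmod (z - x) < R * (1 - cmod z)"
      using elim(3) by (auto simp: stolz_angle_def norm_minus_commute)
    define D u b where "D = cmod (z - x)" and "u = cmod (q z) * D" and "b = cmod (q a) * D"
    have A: "1 - (cmod a)\<^sup>2 > 0" using disc_norm_sq_pos[OF a] .
    have "(cmod (q z - q a))\<^sup>2 * ((1 - (cmod a)\<^sup>2) * (1 - (cmod z)\<^sup>2))
        \<le> 4 * Re (q z) * Re (q a) * (cmod (z - a))\<^sup>2"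
      by (rule schwarz_pick_half_plane[OF q a z])
    also have "\<dots> \<le> 4 * cmod (q z) * (\<epsilon> * Re ((x + a) / (x - a))) * (2 * (cmod (x - a))\<^sup>2)"
      using q(2)[OF z] q(2)[OF a] qa elim(1) complex_Re_le_cmod[of "q z"]
      by (intro mult_mono) auto
    also have "\<dots> = 8 * \<epsilon> * cmod (q z) * (1 - (cmod a)\<^sup>2)"
      using xa by (simp add: Re_cayley[OF x])
    finally have "((cmod (q z - q a))\<^sup>2 * (1 - (cmod z)\<^sup>2)) * (1 - (cmod a)\<^sup>2)
        \<le> (8 * \<epsilon> * cmod (q z)) * (1 - (cmod a)\<^sup>2)" by (simp add: mult_ac)
    then have 1: "(cmod (q z - q a))\<^sup>2 * (1 - (cmod z)\<^sup>2) \<le> 8 * \<epsilon> * cmod (q z)"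
      using A by simp
    have "(cmod z)\<^sup>2 \<le> cmod z" using z by (simp add: power2_eq_square mult_left_le)
    then have "R * (1 - cmod z) \<le> R * (1 - (cmod z)\<^sup>2)" using R by simp
    then have "D \<le> R * (1 - (cmod z)\<^sup>2)" using zR unfolding D_def by linarith
    then have "(cmod (q z - q a))\<^sup>2 * D \<le> (cmod (q z - q a))\<^sup>2 * (R * (1 - (cmod z)\<^sup>2))"
      by (intro mult_left_mono) auto
    also have "\<dots> \<le> R * (8 * \<epsilon> * cmod (q z))"
      using mult_left_mono[OF 1, of R] R by (simp add: mult_ac)
    also have "\<dots> = e / 8 * cmod (q z)" using R by (simp add: \<epsilon>_def)
    finally have "(cmod (q z - q a))\<^sup>2 * D * D \<le> e / 8 * cmod (q z) * D"
      by (rule mult_right_mono) (simp add: D_def)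
    then have 2: "(cmod (q z - q a) * D)\<^sup>2 \<le> e / 8 * u"
      by (simp add: u_def power2_eq_square mult_ac)
    \<comment> \<open>If \<open>u\<close> were at least \<open>e\<close>, then \<open>b\<close> <
      e/4 \<le> u/4, so the triangle inequality leaves 3u/4 on the left of the quadratic estimate.
      It would follow that (9/16) u \<le> e/8, which is absurd.\<close>
    have "u < e"
    proof (rule ccontr)
      assume "\<not> u < e"
      have "cmod (q z) - cmod (q a) \<le> cmod (q z - q a)" by (rule norm_triangle_ineq2)
      then have "(cmod (q z) - cmod (q a)) * D \<le> cmod (q z - q a) * D"
        by (rule mult_right_mono) (simp add: D_def)
      then have "u - b \<le> cmod (q z - q a) * D"
        by (simp add: u_def b_def algebra_simps)
      moreover have "b < e / 4" using elim(2) by (simp add: b_def D_def)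
      ultimately have "3 / 4 * u \<le> cmod (q z - q a) * D" using \<open>\<not> u < e\<close> e by linarith
      then have "(3 / 4 * u)\<^sup>2 \<le> (cmod (q z - q a) * D)\<^sup>2"
        using \<open>\<not> u < e\<close> e by (intro power_mono) auto
      also note 2
      finally have "(9 / 16 * u) * u \<le> (e / 8) * u" by (simp add: power2_eq_square)
      then show False using \<open>\<not> u < e\<close> e by simp
    qed
    then show ?case by (simp add: u_def D_def norm_mult mult.commute)
  qed
qed

text \<open>Subtracting the largest admissible multiple \<open>c\<close> of the kernel
  \<open>W\<close> leaves a function \<open>q1\<close> with nonnegative real part whose ratio to the
  Poisson kernel has infimum 0. The vanishing case applies to \<open>q1\<close>, and the multiple of
  \<open>W\<close> supplies the limit because (z - x) W z = -(x + z).\<close>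

lemma julia_wolff_half_plane:
  assumes q: "q holomorphic_on unit_disc" "\<And>z. z \<in> unit_disc \<Longrightarrow> Re (q z) \<ge> 0"
    and x: "x \<in> sphere 0 1"
  obtains c where "c \<ge> 0" "\<And>z. z \<in> unit_disc \<Longrightarrow> c * Re ((x + z) / (x - z)) \<le> Re (q z)"
    "angular_lim (\<lambda>z. (z - x) * q z) (nhds (- (2 * of_real c * x))) x"
proof -
  define W where "W = (\<lambda>z. (x + z) / (x - z))"
  define Q where "Q = (\<lambda>z. Re (q z) / Re (W z)) ` unit_disc"
  define c where "c = Inf Q"
  have W: "Re (W z) > 0" if "z \<in> unit_disc" for z
    unfolding W_def by (rule Re_cayley_pos[OF x that])
  have Q0: "y \<ge> 0" if "y \<in> Q" for y
    using that q(2) W unfolding Q_def by (force intro: divide_nonneg_pos)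
  have "0 \<in> unit_disc" by simp
  then have Qne: "Q \<noteq> {}" unfolding Q_def by blast
  have bdd: "bdd_below Q" using Q0 by (meson bdd_belowI)
  have c0: "c \<ge> 0" unfolding c_def using Qne Q0 by (intro cInf_greatest) auto
  have cle: "c * Re (W z) \<le> Re (q z)" if "z \<in> unit_disc" for z
  proof -
    have "c \<le> Re (q z) / Re (W z)"
      unfolding c_def using that bdd by (intro cInf_lower) (auto simp: Q_def)
    then show ?thesis using W[OF that] by (simp add: pos_le_divide_eq)
  qed
  define q1 where "q1 = (\<lambda>z. q z - of_real c * W z)"
  have hol: "q1 holomorphic_on unit_disc"
    unfolding q1_def W_def using x by (auto intro!: holomorphic_intros q(1))
  have Re1: "Re (q1 z) \<ge> 0" if "z \<in> unit_disc" for z using cle[OF that] by (simp add: q1_def)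
  have "\<exists>a\<in>unit_disc. Re (q1 a) < \<epsilon> * Re ((x + a) / (x - a))" if \<epsilon>: "\<epsilon> > 0" for \<epsilon>
  proof -
    have "Inf Q < c + \<epsilon>" using \<epsilon> by (simp add: c_def)
    then obtain y where "y \<in> Q" "y < c + \<epsilon>" using cInf_lessD[OF Qne] by blast
    then obtain a where a: "a \<in> unit_disc" "Re (q a) / Re (W a) < c + \<epsilon>" by (auto simp: Q_def)
    then have "Re (q a) < (c + \<epsilon>) * Re (W a)" using W[OF a(1)] by (simp add: pos_divide_less_eq)
    then have "Re (q1 a) < \<epsilon> * Re (W a)" by (simp add: q1_def algebra_simps)
    then show ?thesis using a(1) unfolding W_def by blast
  qed
  then have lim1: "angular_lim (\<lambda>z. (z - x) * q1 z) (nhds 0) x"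
    using hol Re1 x by (intro angular_lim_julia_wolff_zero) auto
  have "angular_lim (\<lambda>z. (z - x) * q z) (nhds (- (2 * of_real c * x))) x"
    unfolding angular_lim_def
  proof (intro allI impI)
    fix R :: real assume "R > 1"
    then have "((\<lambda>z. (z - x) * q1 z - of_real c * (x + z)) \<longlongrightarrow> 0 - of_real c * (x + x))
        (at x within stolz_angle x R)"
      using lim1 unfolding angular_lim_def by (intro tendsto_intros) auto
    moreover have "\<forall>\<^sub>F z in at x within stolz_angle x R.
        (z - x) * q1 z - of_real c * (x + z) = (z - x) * q z"
      using eventually_mem_within
    proof eventually_elim
      case (elim z)
      then have "z \<in> unit_disc" by (auto simp: stolz_angle_def)
      then have "x - z \<noteq> 0" using x by auto
      then have "(z - x) * W z = - (x + z)" unfolding W_def by (simp add: divide_simps) (simp add: algebra_simps)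
      then have "(z - x) * q1 z = (z - x) * q z + of_real c * (x + z)"
        unfolding q1_def by (simp add: right_diff_distrib mult.left_commute distrib_left)
      then show ?case by simp
    qed
    ultimately have "((\<lambda>z. (z - x) * q z) \<longlongrightarrow> 0 - of_real c * (x + x)) (at x within stolz_angle x R)"
      by (rule Lim_transform_eventually)
    then show "((\<lambda>z. (z - x) * q z) \<longlongrightarrow> - (2 * of_real c * x)) (at x within stolz_angle x R)"
      by (simp add: mult_ac)
  qed
  then show thesis using that c0 cle unfolding W_def by blast
qed

section \<open>Primitives with a logarithmic singularity at a boundary point\<close>

lemma filterlim_radial_disc:
  assumes "x \<in> sphere 0 1"
  shows "filterlim (\<lambda>r. of_real r * x) (at x within unit_disc) (at_left 1)"
  using filterlim_radial_stolz[OF assms, of 2]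
  by (rule filterlim_mono[OF _ at_le order_refl]) (auto simp: stolz_angle_def)

text \<open>The hypotheses on \<open>z1\<close> and \<open>z2\<close> say that they lie at distance comparable to \<open>\<delta>\<close> from both \<open>x\<close>
  and the circle; the segment between them then stays in a Stolz angle at \<open>x\<close>.\<close>

lemma two_point_estimate:
  assumes x: "x \<in> sphere 0 1" and e: "e > 0" and g: "g holomorphic_on unit_disc \<inter> ball x e"
    and lim: "angular_lim (\<lambda>z. (z - x) * deriv g z) (nhds L) x"
    and M: "cmod L < M" and R: "R \<ge> 1"
  obtains d where "d > 0"
    "\<And>z1 z2 \<delta>. \<lbrakk>0 < \<delta>; \<delta> < d; cmod (z1 - x) \<le> R * \<delta>; cmod (z2 - x) \<le> R * \<delta>;
       \<delta> \<le> 1 - cmod z1; \<delta> \<le> 1 - cmod z2\<rbrakk> \<Longrightarrow> cmod (g z1 - g z2) \<le> 2 * R * M"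
proof -
  have "((\<lambda>z. cmod ((z - x) * deriv g z)) \<longlongrightarrow> cmod L) (at x within stolz_angle x (R + 1))"
    using lim R unfolding angular_lim_def by (intro tendsto_norm) auto
  then have "\<forall>\<^sub>F z in at x within stolz_angle x (R + 1). cmod ((z - x) * deriv g z) < M"
    using M by (rule order_tendstoD(2))
  then obtain d0 where d0: "d0 > 0" and bnd: "\<And>z. z \<in> stolz_angle x (R + 1) \<Longrightarrow> z \<noteq> x \<Longrightarrow>
      dist z x < d0 \<Longrightarrow> cmod ((z - x) * deriv g z) < M"
    unfolding eventually_at by blast
  have M0: "M > 0" using M by (meson norm_ge_zero le_less_trans)
  show thesis
  proof
    show "min d0 e / R > 0" using d0 e R by simp
    fix z1 z2 \<delta>
    assume \<delta>: "0 < \<delta>" "\<delta> < min d0 e / R"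
      and z: "cmod (z1 - x) \<le> R * \<delta>" "cmod (z2 - x) \<le> R * \<delta>" "\<delta> \<le> 1 - cmod z1" "\<delta> \<le> 1 - cmod z2"
    have R\<delta>: "R * \<delta> < d0" "R * \<delta> < e" using \<delta> R by (simp_all add: pos_less_divide_eq mult.commute)
    \<comment> \<open>A convex set containing both points. On it |w - x| \<le> R (1 - |w|), and the
      opening \<open>R + 1\<close> makes this strict. Since also |w - x| \<ge> \<delta>, the bound
      on (w - x) g' w becomes |g' w| \<le> M/\<delta>, and \<delta> cancels against |z1 - z2| \<le>
      2R\<delta>.\<close>
    define C where "C = cball x (R * \<delta>) \<inter> cball 0 (1 - \<delta>)"
    have C: "w \<in> unit_disc \<inter> ball x e" "cmod (deriv g w) \<le> M / \<delta>" if "w \<in> C" for w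
    proof -
      have w: "cmod (w - x) \<le> R * \<delta>" "\<delta> \<le> 1 - cmod w"
        using that by (auto simp: C_def dist_norm norm_minus_commute)
      have wd: "w \<in> unit_disc" using w \<delta> by simp
      then show "w \<in> unit_disc \<inter> ball x e"
        using w R\<delta> by (auto simp: dist_norm norm_minus_commute)
      have "cmod (x - w) \<le> R * (1 - cmod w)"
        using w R by (metis mult_left_mono norm_minus_commute order_trans zero_le_one)
      also have "\<dots> < (R + 1) * (1 - cmod w)" using w \<delta> by (intro mult_strict_right_mono) auto
      finally have "w \<in> stolz_angle x (R + 1)" using wd by (simp add: stolz_angle_def)
      moreover have "w \<noteq> x" using wd x by auto
      ultimately have 1: "cmod (w - x) * cmod (deriv g w) < M"
        using bnd[of w] w R\<delta> by (simp add: dist_norm norm_mult)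
      have "\<delta> \<le> cmod (w - x)"
        using w x norm_triangle_ineq2[of x w] by (simp add: norm_minus_commute)
      then have "\<delta> * cmod (deriv g w) \<le> cmod (w - x) * cmod (deriv g w)"
        by (rule mult_right_mono) simp
      with 1 have "\<delta> * cmod (deriv g w) \<le> M" by simp
      then show "cmod (deriv g w) \<le> M / \<delta>" using \<delta> by (simp add: pos_le_divide_eq mult.commute)
    qed
    have "cmod (g z1 - g z2) \<le> M / \<delta> * cmod (z1 - z2)"
    proof (rule field_differentiable_bound[where S = C])
      show "convex C" unfolding C_def by (intro convex_Int convex_cball)
      fix w assume w: "w \<in> C"
      have "open (unit_disc \<inter> ball x e)" by auto
      then have "(g has_field_derivative deriv g w) (at w)"
        using C(1)[OF w] g holomorphic_derivI by blast
      then show "(g has_field_derivative deriv g w) (at w within C)"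
        by (rule has_field_derivative_at_within)
    qed (use C(2) z in \<open>auto simp: C_def dist_norm norm_minus_commute\<close>)
    also have "cmod (z1 - z2) \<le> 2 * (R * \<delta>)"
      using z norm_triangle_ineq4[of "z1 - x" "z2 - x"] by simp
    then have "M / \<delta> * cmod (z1 - z2) \<le> M / \<delta> * (2 * (R * \<delta>))"
      using M0 \<delta> by (intro mult_left_mono) auto
    also have "\<dots> = 2 * R * M" using \<delta> by simp
    finally show "cmod (g z1 - g z2) \<le> 2 * R * M" .
  qed
qed

lemma eventually_at_left_disc:
  assumes "x \<in> sphere 0 1" "e > 0"
  shows "\<forall>\<^sub>F r in at_left 1. of_real r * x \<in> unit_disc \<inter> ball x e \<and> 0 < r \<and> r < 1"
proof -
  have "\<forall>\<^sub>F z in at x within unit_disc. z \<in> unit_disc \<inter> ball x e"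
    using assms(2) by (auto simp: eventually_at dist_commute)
  then have "\<forall>\<^sub>F r in at_left 1. of_real r * x \<in> unit_disc \<inter> ball x e"
    using filterlim_radial_disc[OF assms(1)] unfolding filterlim_iff by blast
  moreover have "\<forall>\<^sub>F r in at_left (1::real). r \<in> {0<..<1}"
    by (rule eventually_at_left_real) simp
  ultimately show ?thesis by eventually_elim auto
qed

lemma minus_ln_at_left_one: "filterlim (\<lambda>r::real. - ln (1 - r)) at_top (at_left 1)"
proof -
  have "filterlim (\<lambda>r::real. 1 - r) (at_right 0) (at_left 1)"
    unfolding filterlim_at
    by (auto intro!: tendsto_eq_intros simp: eventually_at_filter)
  then have "filterlim (\<lambda>r::real. ln (1 - r)) at_bot (at_left 1)"
    by (rule filterlim_compose[OF ln_at_0])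
  then show ?thesis by (simp add: filterlim_uminus_at_top)
qed

text \<open>L'Hopital's rule along the radius against \<open>- ln (1 - r)\<close>: the quotient of
  the derivatives is the real part of (z - x) g' z at z = r x. The signs are reversed so that the
  denominator tends to plus infinity.\<close>

lemma radial_log_growth:
  assumes x: "x \<in> sphere 0 1" and e: "e > 0" and g: "g holomorphic_on unit_disc \<inter> ball x e"
    and lim: "angular_lim (\<lambda>z. (z - x) * deriv g z) (nhds L) x"
  shows "((\<lambda>r. Re (g (of_real r * x)) / ln (1 - r)) \<longlongrightarrow> Re L) (at_left 1)"
proof -
  let ?g' = "\<lambda>r. deriv g (of_real r * x)"
  have "((\<lambda>r. - Re (g (of_real r * x)) / (- ln (1 - r))) \<longlongrightarrow> Re L) (at_left 1)"
  proof (rule lhopital_left_at_top)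
    show "filterlim (\<lambda>r::real. - ln (1 - r)) at_top (at_left 1)"
      by (rule minus_ln_at_left_one)
    show "\<forall>\<^sub>F r in at_left 1. 1 / (1 - r) \<noteq> (0::real)"
      by (simp add: eventually_at_filter)
    show "\<forall>\<^sub>F r in at_left 1. DERIV (\<lambda>r. - ln (1 - r)) r :> 1 / (1 - r :: real)"
      unfolding eventually_at_filter
      by (intro always_eventually allI impI) (auto intro!: derivative_eq_intros simp: field_simps)
    show "\<forall>\<^sub>F r in at_left 1. DERIV (\<lambda>r. - Re (g (of_real r * x))) r :> - Re (?g' r * x)"
      using eventually_at_left_disc[OF x e]
    proof eventually_elim
      case (elim r)
      have "open (unit_disc \<inter> ball x e)" by auto
      then have "(g has_field_derivative ?g' r) (at (of_real r * x))"
        using elim g holomorphic_derivI by blast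
      moreover have "((\<lambda>r. of_real r * x) has_vector_derivative x) (at r)"
        by (auto intro!: derivative_eq_intros)
      ultimately have "((g \<circ> (\<lambda>r. of_real r * x)) has_vector_derivative (x * ?g' r)) (at r)"
        by (intro field_vector_diff_chain_at)
      then have "((\<lambda>r. Re (g (of_real r * x))) has_vector_derivative Re (x * ?g' r)) (at r)"
        by (auto intro!: derivative_eq_intros simp: o_def has_vector_derivative_complex_iff has_real_derivative_iff_has_vector_derivative)
      then show ?case
        by (auto intro!: derivative_eq_intros simp: has_real_derivative_iff_has_vector_derivative mult.commute)
    qed
    have "((\<lambda>r. Re ((of_real r * x - x) * ?g' r)) \<longlongrightarrow> Re L) (at_left 1)"
      by (intro tendsto_Re angular_lim_radial[OF lim x])
    moreover have "\<forall>\<^sub>F r in at_left 1. Re ((of_real r * x - x) * ?g' r) = - Re (?g' r * x) / (1 / (1 - r))"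
    proof (intro always_eventually allI)
      fix r :: real
      have "(of_real r * x - x) * ?g' r = of_real (r - 1) * (?g' r * x)"
        by (simp add: algebra_simps)
      then have "Re ((of_real r * x - x) * ?g' r) = (r - 1) * Re (?g' r * x)"
        by (simp only: Re_complex_of_real times_complex.sel Im_complex_of_real)
      then show "Re ((of_real r * x - x) * ?g' r) = - Re (?g' r * x) / (1 / (1 - r))"
        by (simp add: algebra_simps)
    qed
    ultimately show "((\<lambda>r. - Re (?g' r * x) / (1 / (1 - r))) \<longlongrightarrow> Re L) (at_left 1)"
      by (rule Lim_transform_eventually)
  qed
  then show ?thesis by simp
qed

text \<open>On the radius the ratio of \<open>Re g\<close> to \<open>ln (1 - r)\<close> tends to the
  negative number \<open>Re L\<close>, so \<open>Re g\<close> tends to infinity there. Inside a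
  Stolz angle, \<open>z\<close> is compared with the radial point at the same distance from
  \<open>x\<close>; by \<open>two_point_estimate\<close> the values of \<open>g\<close> differ by a
  bounded amount.\<close>

lemma angular_growth:
  assumes x: "x \<in> sphere 0 1" and e: "e > 0" and g: "g holomorphic_on unit_disc \<inter> ball x e"
    and lim: "angular_lim (\<lambda>z. (z - x) * deriv g z) (nhds L) x" and L: "Re L < 0"
  shows "angular_lim (\<lambda>z. Re (g z)) at_top x"
  unfolding angular_lim_def
proof (intro allI impI)
  fix R :: real assume R: "R > 1"
  let ?F = "at x within stolz_angle x R"
  define M where "M = cmod L + 1"
  obtain d where d: "d > 0" and two: "\<And>z1 z2 \<delta>. \<lbrakk>0 < \<delta>; \<delta> < d; cmod (z1 - x) \<le> R * \<delta>;
      cmod (z2 - x) \<le> R * \<delta>; \<delta> \<le> 1 - cmod z1; \<delta> \<le> 1 - cmod z2\<rbrakk> \<Longrightarrow> cmod (g z1 - g z2) \<le> 2 * R * M"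
    using two_point_estimate[OF x e g lim, of M R] R by (auto simp: M_def)
  have "filterlim (\<lambda>r. Re (g (of_real r * x)) / ln (1 - r) * ln (1 - r)) at_top (at_left 1)"
    using filterlim_tendsto_neg_mult_at_bot[OF radial_log_growth[OF x e g lim] L minus_ln_at_left_one]
    by (simp add: filterlim_uminus_at_top)
  moreover have "\<forall>\<^sub>F r in at_left (1::real).
      Re (g (of_real r * x)) / ln (1 - r) * ln (1 - r) = Re (g (of_real r * x))"
    using eventually_at_left_real[of 0 1] by (rule eventually_mono) auto
  ultimately have rad: "filterlim (\<lambda>r. Re (g (of_real r * x))) at_top (at_left 1)"
    using filterlim_cong[OF refl refl] by fast
  have "filterlim (\<lambda>z. 1 - cmod (z - x)) (at_left 1) ?F"
    unfolding filterlim_at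
    by (auto intro!: tendsto_eq_intros simp: eventually_at_filter)
  from filterlim_compose[OF rad this]
  have "filterlim (\<lambda>z. - (2 * R * M) + Re (g (of_real (1 - cmod (z - x)) * x))) at_top ?F"
    by (intro filterlim_tendsto_add_at_top[OF tendsto_const])
  then show "filterlim (\<lambda>z. Re (g z)) at_top ?F"
  proof (rule filterlim_at_top_mono)
    have "\<forall>\<^sub>F z in ?F. dist z x < min d 1"
      using d by (auto simp: eventually_at intro!: exI[of _ "min d 1"])
    moreover have "\<forall>\<^sub>F z in ?F. z \<noteq> x" by (simp add: eventually_at_filter)
    ultimately show "\<forall>\<^sub>F z in ?F. - (2 * R * M) + Re (g (of_real (1 - cmod (z - x)) * x)) \<le> Re (g z)"
      using eventually_mem_within
    proof eventually_elim
      case (elim z)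
      define t where "t = cmod (z - x)"
      have t: "0 < t" "t < d" "t < 1" using elim(1,2) by (auto simp: t_def dist_norm)
      have tR: "t < R * (1 - cmod z)"
        using elim(3) by (auto simp: stolz_angle_def t_def norm_minus_commute)
      have tt: "t / R \<le> t" using t R by (simp add: field_simps)
      have "of_real (1 - t) * x - x = - of_real t * x" by (simp add: algebra_simps)
      then have n1: "cmod (of_real (1 - t) * x - x) = t"
        using x t by (simp add: norm_mult)
      have n2: "cmod (of_real (1 - t) * x) = 1 - t"
        using x t by (simp add: norm_mult del: of_real_diff)
      \<comment> \<open>Here \<delta> is \<open>t / R\<close>: the Stolz condition says t/R < 1 -
        |z|, and both points have distance t = R\<delta> from \<open>x\<close>.\<close>
      have "cmod (g z - g (of_real (1 - t) * x)) \<le> 2 * R * M"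
      proof (rule two[of "t / R"])
        show "t / R < d" using tt t by linarith
        show "t / R \<le> 1 - cmod z" using tR R by (simp add: pos_divide_le_eq mult.commute)
        show "cmod (z - x) \<le> R * (t / R)" using R by (simp add: t_def)
      qed (use t R n1 n2 tt in auto)
      then have "\<bar>Re (g z - g (of_real (1 - t) * x))\<bar> \<le> 2 * R * M"
        using abs_Re_le_cmod order_trans by blast
      then show ?case by (simp add: t_def)
    qed
  qed
qed

section \<open>The flow of the generator\<close>

lemma disc_semigroupD:
  assumes "disc_semigroup \<phi>" "t \<ge> 0"
  shows "\<phi> t holomorphic_on unit_disc" "\<phi> t ` unit_disc \<subseteq> unit_disc"
    "z \<in> unit_disc \<Longrightarrow> \<phi> t z \<in> unit_disc" "z \<in> unit_disc \<Longrightarrow> \<phi> 0 z = z"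
  using assms unfolding disc_semigroup_def by (simp_all add: image_subset_iff)

lemma generator_chain:
  assumes \<phi>: "disc_semigroup \<phi>" "generator_of \<phi> G" and t: "t \<ge> 0" and z: "z \<in> unit_disc"
    and H: "(H has_field_derivative H') (at (\<phi> t z))"
  shows "((\<lambda>s. H (\<phi> s z)) has_vector_derivative G (\<phi> t z) * H') (at t within {0..})"
proof -
  have "((\<lambda>s. \<phi> s z) has_vector_derivative G (\<phi> t z)) (at t within {0..})"
    using \<phi>(2) t z unfolding generator_of_def by blast
  then have "((H \<circ> (\<lambda>s. \<phi> s z)) has_vector_derivative (G (\<phi> t z) * H')) (at t within {0..})"
    by (rule field_vector_diff_chain_within) (rule has_field_derivative_at_within[OF H])
  then show ?thesis by (simp add: o_def)
qed

lemma deriv_at_flow: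
  assumes "disc_semigroup \<phi>" "h holomorphic_on unit_disc" "t \<ge> 0" "z \<in> unit_disc"
  shows "(h has_field_derivative deriv h (\<phi> t z)) (at (\<phi> t z))"
  using holomorphic_derivI[OF assms(2) open_ball disc_semigroupD(3)[OF assms(1,3,4)]] .

lemma has_vector_derivative_zero_atLeast:
  fixes f :: "real \<Rightarrow> 'a::real_normed_vector"
  assumes "\<And>s. s \<ge> 0 \<Longrightarrow> (f has_vector_derivative 0) (at s within {0..})" and t: "t \<ge> 0"
  shows "f t = f 0"
proof (rule has_derivative_zero_unique[where s = "{0..}" and x = t and y = 0])
  show "(f has_derivative (\<lambda>h. 0)) (at s within {0..})" if "s \<in> {0..}" for s
    using assms(1)[of s] that by (simp add: has_vector_derivative_def)
qed (use t in auto)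

lemma flow_additive:
  assumes \<phi>: "disc_semigroup \<phi>" "generator_of \<phi> G"
    and h: "h holomorphic_on unit_disc" "\<And>z. z \<in> unit_disc \<Longrightarrow> deriv h z * G z = 1"
    and t: "t \<ge> 0" and z: "z \<in> unit_disc"
  shows "h (\<phi> t z) = h z + of_real t"
proof -
  have "((\<lambda>s. h (\<phi> s z) - of_real s) has_vector_derivative 0) (at s within {0..})" if s: "s \<ge> 0" for s
  proof -
    have "G (\<phi> s z) * deriv h (\<phi> s z) = 1"
      using h(2)[OF disc_semigroupD(3)[OF \<phi>(1) s z]] by (simp add: mult.commute)
    then show ?thesis
      using generator_chain[OF \<phi> s z deriv_at_flow[OF \<phi>(1) h(1) s z]]
      by (auto intro!: derivative_eq_intros)
  qed
  from has_vector_derivative_zero_atLeast[OF this t]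
  have "h (\<phi> t z) - of_real t = h (\<phi> 0 z) - of_real 0" .
  then show ?thesis using disc_semigroupD(4)[OF \<phi>(1) t z] by (simp add: algebra_simps)
qed

text \<open>With the integrating factor exp (-\<kappa> s) the derivative along the flow vanishes.
  This serves both for the Koenigs function and for the Moebius map in
  \<open>elliptic_group_rotation\<close>.\<close>

lemma flow_multiplicative:
  assumes \<phi>: "disc_semigroup \<phi>" "generator_of \<phi> G"
    and h: "h holomorphic_on unit_disc" "\<And>z. z \<in> unit_disc \<Longrightarrow> deriv h z * G z = \<kappa> * h z"
    and t: "t \<ge> 0" and z: "z \<in> unit_disc"
  shows "h (\<phi> t z) = exp (\<kappa> * of_real t) * h z"
proof -
  have "((\<lambda>s. exp (- \<kappa> * of_real s) * h (\<phi> s z)) has_vector_derivative 0) (at s within {0..})"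
    if s: "s \<ge> 0" for s
  proof -
    have eq: "G (\<phi> s z) * deriv h (\<phi> s z) = \<kappa> * h (\<phi> s z)"
      using h(2)[OF disc_semigroupD(3)[OF \<phi>(1) s z]] by (simp add: mult.commute)
    have "((\<lambda>s. exp (- \<kappa> * of_real s)) has_vector_derivative (- \<kappa> * exp (- \<kappa> * of_real s))) (at s within {0..})"
      by (rule has_vector_derivative_real_field) (auto intro!: derivative_eq_intros)
    from has_vector_derivative_mult[OF this generator_chain[OF \<phi> s z deriv_at_flow[OF \<phi>(1) h(1) s z]]]
    show ?thesis unfolding eq by (simp add: algebra_simps)
  qed
  from has_vector_derivative_zero_atLeast[OF this t]
  have "exp (- \<kappa> * of_real t) * h (\<phi> t z) = h z"
    using disc_semigroupD(4)[OF \<phi>(1) t z] by simp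
  then have "exp (\<kappa> * of_real t) * (exp (- \<kappa> * of_real t) * h (\<phi> t z)) = exp (\<kappa> * of_real t) * h z"
    by simp
  then show ?thesis by (simp add: mult.assoc[symmetric] exp_add[symmetric])
qed

text \<open>The Moebius map \<open>T\<close> sending \<tau> to 0 linearises the flow: T' G = \<mu>
  T, where \<mu> is G'(\<tau>) and purely imaginary. Hence every \<open>\<phi> t\<close> is
  conjugate to a rotation.\<close>

lemma elliptic_group_rotation:
  assumes \<phi>: "disc_semigroup \<phi>" "generator_of \<phi> G" and \<tau>: "\<tau> \<in> unit_disc"
    and G: "\<And>z. z \<in> unit_disc \<Longrightarrow> G z = (z - \<tau>) * (cnj \<tau> * z - 1) * b" and b: "Re b = 0"
  shows "elliptic_group \<phi>"
proof -
  define T where "T = Moebius_function 0 \<tau>"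
  define S where "S = Moebius_function 0 (- \<tau>)"
  define \<mu> where "\<mu> = - (1 - cnj \<tau> * \<tau>) * b"
  have T: "T holomorphic_on unit_disc" "T ` unit_disc \<subseteq> unit_disc"
    and S: "S holomorphic_on unit_disc" "S ` unit_disc \<subseteq> unit_disc"
    using \<tau> by (auto simp: T_def S_def intro!: Moebius_function_holomorphic Moebius_function_norm_lt_1)
  have ST: "S (T z) = z" and TS: "T (S z) = z" if "z \<in> unit_disc" for z
    using that \<tau> by (auto simp: T_def S_def intro!: Moebius_function_compose)
  have dT: "deriv T z * G z = \<mu> * T z" if z: "z \<in> unit_disc" for z
  proof -
    have ne: "1 - cnj \<tau> * z \<noteq> 0" using disc_cross_nonzero \<tau> z by auto
    have "(T has_field_derivative ((1 - cnj \<tau> * z) + cnj \<tau> * (z - \<tau>)) / (1 - cnj \<tau> * z)\<^sup>2) (at z)"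
      unfolding T_def Moebius_function_simple[abs_def] using ne
      by (auto intro!: derivative_eq_intros simp: power2_eq_square algebra_simps)
    then have "deriv T z = (1 - cnj \<tau> * \<tau>) / (1 - cnj \<tau> * z)\<^sup>2"
      by (simp add: DERIV_imp_deriv algebra_simps)
    then have "deriv T z * G z = (1 - cnj \<tau> * \<tau>) / (1 - cnj \<tau> * z)\<^sup>2 * ((z - \<tau>) * (- (1 - cnj \<tau> * z)) * b)"
      using G[OF z] by simp
    also have "\<dots> = \<mu> * T z"
    proof -
      have "k / u\<^sup>2 * (s * (- u) * b) = - k * b * (s / u)" if "u \<noteq> 0" for k u s :: complex
        using that by (simp add: field_simps power2_eq_square)
      then show ?thesis unfolding \<mu>_def T_def Moebius_function_simple using ne by blast
    qed
    finally show ?thesis .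
  qed
  have Re\<mu>: "Re (\<mu> * of_real t) = 0" for t
    using b by (simp add: \<mu>_def)
  have n1: "cmod (exp (\<mu> * of_real t)) = 1" "cmod (exp (- \<mu> * of_real t)) = 1" for t
    using Re\<mu>[of t] by (auto simp: norm_exp_eq_Re)
  have flow: "T (\<phi> t z) = exp (\<mu> * of_real t) * T z" if "t \<ge> 0" "z \<in> unit_disc" for t z
    by (rule flow_multiplicative[OF \<phi> T(1) dT that])
  have "disc_automorphism (\<phi> t) \<and> \<phi> t \<tau> = \<tau>" if t: "t \<ge> 0" for t
  proof
    \<comment> \<open>The candidate for the inverse of \<open>\<phi> t\<close>: the opposite
      rotation, conjugated by \<open>T\<close>.\<close>
    define g where "g = (\<lambda>z. S (exp (- \<mu> * of_real t) * T z))"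
    have rot: "exp (\<mu> * of_real t) * w \<in> unit_disc" "exp (- \<mu> * of_real t) * w \<in> unit_disc"
      if "w \<in> unit_disc" for w
      using n1[of t] that by (simp_all add: norm_mult del: norm_exp_eq_Re)
    have inv: "exp (\<mu> * of_real t) * (exp (- \<mu> * of_real t) * w) = w"
      "exp (- \<mu> * of_real t) * (exp (\<mu> * of_real t) * w) = w" for w
      by (simp_all add: mult.assoc[symmetric] exp_add[symmetric])
    have Td: "T z \<in> unit_disc" if "z \<in> unit_disc" for z using T(2) that by blast
    have Sd: "S z \<in> unit_disc" if "z \<in> unit_disc" for z using S(2) that by blast
    note \<phi>d = disc_semigroupD(3)[OF \<phi>(1) t]
    have "(S \<circ> (\<lambda>z. exp (- \<mu> * of_real t) * T z)) holomorphic_on unit_disc"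
      using rot(2)[OF Td]
      by (intro holomorphic_on_compose_gen[OF _ S(1)] holomorphic_intros T(1)) auto
    then have "g holomorphic_on unit_disc" by (simp add: g_def o_def)
    moreover have "g ` unit_disc \<subseteq> unit_disc"
      using Sd[OF rot(2)[OF Td]] by (auto simp: g_def simp del: mem_ball_0 mem_ball)
    moreover have "g (\<phi> t z) = z" if z: "z \<in> unit_disc" for z
      unfolding g_def flow[OF t z] inv ST[OF z] ..
    moreover have "\<phi> t (g z) = z" if z: "z \<in> unit_disc" for z
    proof -
      have gz: "g z \<in> unit_disc" using Sd[OF rot(2)[OF Td[OF z]]] by (simp add: g_def)
      have "T (\<phi> t (g z)) = exp (\<mu> * of_real t) * T (g z)" by (rule flow[OF t gz])
      also have "\<dots> = T z" unfolding g_def TS[OF rot(2)[OF Td[OF z]]] inv ..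
      finally show ?thesis using ST[OF \<phi>d[OF gz]] ST[OF z] by metis
    qed
    ultimately show "disc_automorphism (\<phi> t)"
      unfolding disc_automorphism_def using disc_semigroupD(1,2)[OF \<phi>(1) t] by blast
    have "T (\<phi> t \<tau>) = T \<tau>"
      using flow[OF t \<tau>] by (simp add: T_def Moebius_function_eq_zero)
    then show "\<phi> t \<tau> = \<tau>" using ST[OF \<phi>d[OF \<tau>]] ST[OF \<tau>] by metis
  qed
  then show ?thesis unfolding elliptic_group_def using \<phi>(1) \<tau> by blast
qed

section \<open>Boundary regular fixed points\<close>

lemma Re_of_real_mult: "Re (of_real a * z) = a * Re z"
  by simp

text \<open>The Cayley transform \<open>w = (x + z) / (x - z)\<close> sends \<open>x\<close> to infinity, and in this coordinate the
  generator reads \<open>- K (w - a) (w + cnj a) / q\<close> with \<open>K = |x - \<tau>|\<^sup>2 / 2\<close> and \<open>a\<close> the image of \<open>\<tau>\<close>.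
  The bound below makes \<open>exp (K t / c) * Re w\<close> nondecreasing along the flow, which is the
  conclusion of Julia's lemma for the maps of the semigroup.\<close>

lemma half_plane_generator_bound:
  assumes w: "Re w > 0" and a: "Re a \<ge> 0" and c: "c > 0" and q: "c * Re w \<le> Re q"
  shows "c * Re ((w - a) * (w + cnj a) / q) \<le> Re w"
proof -
  \<comment> \<open>after this vertical translation \<open>a\<close> becomes real\<close>
  define v where "v = w - \<i> * of_real (Im a)"
  define q2 where "q2 = q - of_real c * v"
  have Rev: "Re v = Re w" by (simp add: v_def)
  have q2: "Re q2 \<ge> 0" using q by (simp add: q2_def Rev)
  have "Re q > 0" using mult_pos_pos[OF c w] q by linarith
  then have q0: "q \<noteq> 0" by auto
  \<comment> \<open>Here (w - a)(w + cnj a) = v^2 - (Re a)^2, and c v^2 = v (q - q2). After division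
    by \<open>q\<close> both subtracted terms have nonnegative real part, the first because cnj q =
    cnj q2 + c cnj v.\<close>
  have "of_real c * ((w - a) * (w + cnj a)) = v * q - (v * q2 + of_real (c * (Re a)\<^sup>2))"
    by (simp add: complex_eq_iff v_def q2_def power2_eq_square algebra_simps)
  then have "of_real c * ((w - a) * (w + cnj a) / q) = v - (v * q2 / q + of_real (c * (Re a)\<^sup>2) / q)"
    using q0 by (simp add: divide_simps)
  then have "Re (of_real c * ((w - a) * (w + cnj a) / q))
      = Re v - (Re (v * q2 / q) + Re (of_real (c * (Re a)\<^sup>2) / q))"
    by (metis minus_complex.sel(1) plus_complex.sel(1))
  moreover have "Re (v * q2 / q) \<ge> 0"
  proof -
    have "Re (v * q2 * cnj q) = c * (cmod v)\<^sup>2 * Re q2 + (cmod q2)\<^sup>2 * Re v"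
      unfolding cmod_power2 by (simp add: q2_def power2_eq_square algebra_simps)
    then show ?thesis using c q2 w by (simp add: Re_complex_div_ge_0 Rev)
  qed
  moreover have "Re (of_real (c * (Re a)\<^sup>2) / q) \<ge> 0"
    using c \<open>Re q > 0\<close> by (simp add: Re_complex_div_ge_0)
  ultimately show ?thesis unfolding Re_of_real_mult Rev by linarith
qed

text \<open>The factor \<open>2 * x / (x - z)\<^sup>2\<close> is the derivative of the Cayley
  transform, so division by \<open>q z\<close> yields the generator in the half-plane
  coordinate.\<close>

lemma generator_cayley:
  assumes x: "x \<in> sphere 0 1" and \<tau>: "\<tau> \<noteq> x" and z: "z \<noteq> x"
  defines "a \<equiv> (x + \<tau>) / (x - \<tau>)" and "w \<equiv> (x + z) / (x - z)"
  shows "2 * x / (x - z)\<^sup>2 * ((z - \<tau>) * (cnj \<tau> * z - 1))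
    = - of_real ((cmod (x - \<tau>))\<^sup>2 / 2) * ((w - a) * (w + cnj a))"
proof -
  have xx: "x * cnj x = 1" using x complex_norm_square[of x] by simp
  have ne: "x - \<tau> \<noteq> 0" "x - z \<noteq> 0" using \<tau> z by auto
  have ne': "cnj x - cnj \<tau> \<noteq> 0" using \<tau> by (metis complex_cnj_cancel_iff right_minus_eq)
  have "w - a = ((x + z) * (x - \<tau>) - (x + \<tau>) * (x - z)) / ((x - z) * (x - \<tau>))"
    unfolding w_def a_def using ne by (simp add: diff_frac_eq mult.commute)
  also have "(x + z) * (x - \<tau>) - (x + \<tau>) * (x - z) = 2 * x * (z - \<tau>)"
    by (simp add: algebra_simps)
  finally have wa: "w - a = 2 * x * (z - \<tau>) / ((x - z) * (x - \<tau>))" .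
  have "w + cnj a = ((x + z) * (cnj x - cnj \<tau>) + (cnj x + cnj \<tau>) * (x - z)) / ((x - z) * (cnj x - cnj \<tau>))"
    unfolding w_def a_def using ne ne' by (simp add: add_frac_eq mult.commute)
  also have "(x + z) * (cnj x - cnj \<tau>) + (cnj x + cnj \<tau>) * (x - z) = 2 * (1 - cnj \<tau> * z)"
    using xx by (simp add: algebra_simps)
  finally have wb: "w + cnj a = 2 * (1 - cnj \<tau> * z) / ((x - z) * (cnj x - cnj \<tau>))" .
  have n: "complex_of_real ((cmod (x - \<tau>))\<^sup>2 / 2) = (x - \<tau>) * (cnj x - cnj \<tau>) / 2"
    using complex_norm_square[of "x - \<tau>"] by simp
  show ?thesis unfolding wa wb n using ne ne'
    by (simp add: power2_eq_square divide_simps) (simp add: algebra_simps)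
qed

lemma flow_cayley_growth:
  assumes \<phi>: "disc_semigroup \<phi>" "generator_of \<phi> G"
    and x: "x \<in> sphere 0 1" and \<tau>: "\<tau> \<in> cball 0 1" "\<tau> \<noteq> x"
    and G: "\<And>z. z \<in> unit_disc \<Longrightarrow> G z = (z - \<tau>) * (cnj \<tau> * z - 1) / q z"
    and c: "c > 0" "\<And>z. z \<in> unit_disc \<Longrightarrow> c * Re ((x + z) / (x - z)) \<le> Re (q z)"
    and t: "t \<ge> 0" and z: "z \<in> unit_disc"
  shows "exp (- (cmod (x - \<tau>))\<^sup>2 / (2 * c) * t) * Re ((x + z) / (x - z))
    \<le> Re ((x + \<phi> t z) / (x - \<phi> t z))"
proof -
  define K where "K = (cmod (x - \<tau>))\<^sup>2 / 2"
  define W where "W = (\<lambda>z. (x + z) / (x - z))"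
  have K: "K > 0" using \<tau> by (simp add: K_def)
  have "Re (W \<tau>) \<ge> 0"
    unfolding W_def Re_cayley[OF x] using \<tau> by (simp add: power_le_one)
  \<comment> \<open>Along the flow, \<open>Re W\<close> decreases at relative rate at most
    K/c.\<close>
  then have low: "- (K / c) * Re (W u) \<le> Re (2 * x / (x - u)\<^sup>2 * G u)" if u: "u \<in> unit_disc" for u
  proof -
    have "2 * x / (x - u)\<^sup>2 * G u = 2 * x / (x - u)\<^sup>2 * ((u - \<tau>) * (cnj \<tau> * u - 1)) / q u"
      using G[OF u] by simp
    also have "\<dots> = - of_real K * ((W u - W \<tau>) * (W u + cnj (W \<tau>))) / q u"
      using generator_cayley[OF x \<tau>(2), of u] sphere_ne_disc[OF x u] by (simp add: K_def W_def)
    finally have "Re (2 * x / (x - u)\<^sup>2 * G u) = - K * Re ((W u - W \<tau>) * (W u + cnj (W \<tau>)) / q u)"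
      by (simp only: times_divide_eq_right[symmetric] of_real_minus[symmetric] Re_of_real_mult)
    moreover have "c * Re ((W u - W \<tau>) * (W u + cnj (W \<tau>)) / q u) \<le> Re (W u)"
      using half_plane_generator_bound[OF _ \<open>Re (W \<tau>) \<ge> 0\<close> c(1)] Re_cayley_pos[OF x u] c(2)[OF u]
      by (simp add: W_def)
    then have "K * Re ((W u - W \<tau>) * (W u + cnj (W \<tau>)) / q u) \<le> K * (Re (W u) / c)"
      using c(1) K by (intro mult_left_mono) (auto simp: pos_le_divide_eq mult.commute)
    ultimately show ?thesis by simp
  qed
  define k where "k = K / c"
  define f where "f = (\<lambda>s. exp (k * s) * Re (W (\<phi> s z)))"
  have df: "\<exists>y. (f has_real_derivative y) (at s within {0..}) \<and> y \<ge> 0" if s: "s \<ge> 0" for s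
  proof -
    define u where "u = \<phi> s z"
    have u: "u \<in> unit_disc" unfolding u_def by (rule disc_semigroupD(3)[OF \<phi>(1) s z])
    have ne: "x - u \<noteq> 0" using sphere_ne_disc[OF x u] by simp
    have "(W has_field_derivative 2 * x / (x - u)\<^sup>2) (at u)"
      unfolding W_def using ne
      by (auto intro!: derivative_eq_intros simp: power2_eq_square algebra_simps)
    then have "((\<lambda>s. W (\<phi> s z)) has_vector_derivative G u * (2 * x / (x - u)\<^sup>2)) (at s within {0..})"
      using generator_chain[OF \<phi> s z] unfolding u_def by blast
    then have "((\<lambda>s. Re (W (\<phi> s z))) has_real_derivative Re (G u * (2 * x / (x - u)\<^sup>2))) (at s within {0..})"
      by (simp add: has_vector_derivative_complex_iff)
    moreover have "((\<lambda>s. exp (k * s)) has_real_derivative k * exp (k * s)) (at s within {0..})"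
      by (auto intro!: derivative_eq_intros)
    ultimately have "(f has_real_derivative
        k * exp (k * s) * Re (W u) + Re (G u * (2 * x / (x - u)\<^sup>2)) * exp (k * s)) (at s within {0..})"
      unfolding f_def u_def by (intro DERIV_mult)
    moreover have "exp (k * s) * (k * Re (W u) + Re (G u * (2 * x / (x - u)\<^sup>2))) \<ge> 0"
      using low[OF u, folded k_def] by (intro mult_nonneg_nonneg) (auto simp: mult.commute)
    ultimately show ?thesis by (force simp: algebra_simps)
  qed
  \<comment> \<open>The derivative within \<open>{0..}\<close> is two-sided only at positive times,
    hence the criterion with derivatives on the open interval and continuity on the closed
    one.\<close>
  have "f 0 \<le> f t"
  proof (rule DERIV_nonneg_imp_increasing_open[OF t])
    fix s assume s: "0 < s" "s < t"
    then have "at s within {0..} = at s" by (intro at_within_interior) (simp add: interior_real_atLeast)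
    then show "\<exists>y. DERIV f s :> y \<and> y \<ge> 0" using df[of s] s by simp
  next
    have "continuous_on {0..} f"
      using df by (force simp: continuous_on_eq_continuous_within intro: DERIV_continuous)
    then show "continuous_on {0..t} f" by (rule continuous_on_subset) auto
  qed
  then have "Re (W z) \<le> exp (k * t) * Re (W (\<phi> t z))"
    using disc_semigroupD(4)[OF \<phi>(1) t z] by (simp add: f_def)
  then have "exp (- (k * t)) * Re (W z) \<le> exp (- (k * t)) * (exp (k * t) * Re (W (\<phi> t z)))"
    by (intro mult_left_mono) auto
  then show ?thesis by (simp add: mult.assoc[symmetric] exp_add[symmetric] W_def K_def k_def)
qed

text \<open>The growth hypothesis says that \<open>f\<close> maps horodiscs at \<open>x\<close> into
  horodiscs at \<open>x\<close>. In a Stolz angle the kernel at \<open>z\<close> is at least 1/(R |x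
  - z|), while at \<open>f z\<close> it is at most 2/|x - f z|. So |x - f z| is bounded by a
  multiple of |x - z|, which gives the angular limit and, along the radius, the finite
  liminf.\<close>

lemma boundary_regular_fixed_pointI:
  assumes x: "x \<in> sphere 0 1" and f: "f ` unit_disc \<subseteq> unit_disc" and A: "A > 0"
    and grow: "\<And>z. z \<in> unit_disc \<Longrightarrow> A * Re ((x + z) / (x - z)) \<le> Re ((x + f z) / (x - f z))"
  shows "boundary_regular_fixed_point f x"
proof -
  have est: "cmod (x - f z) \<le> 2 * R / A * cmod (x - z)" if z: "z \<in> stolz_angle x R" "R > 1" for z R
  proof -
    have zd: "z \<in> unit_disc" and zR: "cmod (x - z) < R * (1 - cmod z)"
      using z by (auto simp: stolz_angle_def)
    have fd: "f z \<in> unit_disc" using f zd by blast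
    define D E where "D = cmod (x - z)" and "E = cmod (x - f z)"
    have D: "D > 0" and E: "E > 0" using sphere_ne_disc[OF x zd] sphere_ne_disc[OF x fd] by (auto simp: D_def E_def)
    have "(cmod z)\<^sup>2 \<le> cmod z" using zd by (simp add: power2_eq_square mult_left_le)
    then have "R * (1 - cmod z) \<le> R * (1 - (cmod z)\<^sup>2)" using z by simp
    then have 1: "D \<le> R * (1 - (cmod z)\<^sup>2)" using zR by (simp add: D_def)
    have "1 - cmod (f z) \<le> E" using norm_triangle_ineq2[of x "f z"] x by (simp add: E_def)
    moreover have "(1 - cmod (f z)) * (1 + cmod (f z)) \<le> (1 - cmod (f z)) * 2"
      using fd by (intro mult_left_mono) auto
    ultimately have 2: "1 - (cmod (f z))\<^sup>2 \<le> 2 * E"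
      by (simp add: power2_eq_square algebra_simps)
    have "A * (1 / (R * D)) \<le> A * ((1 - (cmod z)\<^sup>2) / D\<^sup>2)"
      using A 1 D z by (intro mult_left_mono) (auto simp: divide_simps power2_eq_square mult_ac)
    also have "\<dots> \<le> (1 - (cmod (f z))\<^sup>2) / E\<^sup>2"
      using grow[OF zd] by (simp add: Re_cayley[OF x] D_def E_def)
    also have "\<dots> \<le> 2 * E / E\<^sup>2" using 2 by (intro divide_right_mono) auto
    also have "\<dots> = 2 / E" using E by (simp add: power2_eq_square)
    finally have "A * E \<le> 2 * (R * D)"
      using D E z by (simp add: field_simps)
    then show ?thesis using A unfolding D_def[symmetric] E_def[symmetric]
      by (simp add: pos_le_divide_eq mult_ac)
  qed
  have "angular_lim f (nhds x) x"
    unfolding angular_lim_def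
  proof (intro allI impI)
    fix R :: real assume R: "R > 1"
    have "((\<lambda>z. f z - x) \<longlongrightarrow> 0) (at x within stolz_angle x R)"
    proof (rule Lim_null_comparison)
      show "\<forall>\<^sub>F z in at x within stolz_angle x R. norm (f z - x) \<le> 2 * R / A * cmod (x - z)"
        using eventually_mem_within by eventually_elim (use est R in \<open>simp add: norm_minus_commute\<close>)
      show "((\<lambda>z. 2 * R / A * cmod (x - z)) \<longlongrightarrow> 0) (at x within stolz_angle x R)"
        using A by (auto intro!: tendsto_eq_intros)
    qed
    then show "(f \<longlongrightarrow> x) (at x within stolz_angle x R)" by (simp add: LIM_zero_iff)
  qed
  moreover have "Liminf (at x within unit_disc) (\<lambda>z. ereal ((1 - cmod (f z)) / (1 - cmod z))) < \<infinity>"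
  proof (rule ccontr)
    assume "\<not> ?thesis"
    \<comment> \<open>\<open>4 / A\<close> is the constant of \<open>est\<close> for Stolz opening
      2, so a larger liminf is refuted on the radius.\<close>
    then have "ereal (4 / A) < Liminf (at x within unit_disc) (\<lambda>z. ereal ((1 - cmod (f z)) / (1 - cmod z)))"
      by simp
    then have "\<forall>\<^sub>F z in at x within unit_disc. 4 / A < (1 - cmod (f z)) / (1 - cmod z)"
      using less_LiminfD by force
    then have "\<forall>\<^sub>F z in at x within stolz_angle x 2. 4 / A < (1 - cmod (f z)) / (1 - cmod z)"
      by (rule filter_leD[OF at_le, rotated]) (auto simp: stolz_angle_def)
    then have "\<forall>\<^sub>F z in at x within stolz_angle x 2. 4 / A < (1 - cmod (f z)) / (1 - cmod z) \<and> z \<in> stolz_angle x 2"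
      using eventually_mem_within by (rule eventually_conj)
    then have "\<forall>\<^sub>F r in at_left (1::real). 4 / A < (1 - cmod (f (of_real r * x))) / (1 - cmod (of_real r * x))
        \<and> of_real r * x \<in> stolz_angle x 2"
      using filterlim_radial_stolz[OF x, of 2] unfolding filterlim_iff by force
    moreover have "\<forall>\<^sub>F r in at_left (1::real). r \<in> {0<..<1}" by (rule eventually_at_left_real) simp
    ultimately have "\<forall>\<^sub>F r in at_left (1::real). False"
    proof eventually_elim
      case (elim r)
      have "x - of_real r * x = of_real (1 - r) * x" by (simp add: algebra_simps)
      then have n: "cmod (x - of_real r * x) = 1 - r" "cmod (of_real r * x) = r"
        using elim x by (simp_all add: norm_mult del: of_real_diff)
      have "1 - cmod (f (of_real r * x)) \<le> cmod (x - f (of_real r * x))"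
        using norm_triangle_ineq2[of x "f (of_real r * x)"] x by simp
      also have "\<dots> \<le> 4 / A * (1 - r)" using est[of "of_real r * x" 2] elim n by simp
      finally have "(1 - cmod (f (of_real r * x))) / (1 - r) \<le> 4 / A"
        using elim(2) by (simp add: pos_divide_le_eq)
      then show False using elim n by simp
    qed
    then show False by simp
  qed
  ultimately show ?thesis using x unfolding boundary_regular_fixed_point_def by blast
qed

text \<open>Schwarz-Pick based at 0. It keeps the image of a radial point far enough from the circle
  for \<open>two_point_estimate\<close>.\<close>

lemma disc_self_map_distance:
  assumes f: "f holomorphic_on unit_disc" "f ` unit_disc \<subseteq> unit_disc" and z: "z \<in> unit_disc"
  shows "(1 - cmod (f 0)) / 4 * (1 - cmod z) \<le> 1 - cmod (f z)"
proof -
  have f0: "f 0 \<in> unit_disc" and fz: "f z \<in> unit_disc" using f(2) z by (auto simp del: mem_ball_0 mem_ball) 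
  define m where "m = 1 - cmod (f 0)"
  have m: "m > 0" using f0 by (simp add: m_def)
  have "cmod (cnj (f 0) * f z) \<le> cmod (f 0)" using fz by (simp add: norm_mult mult_left_le)
  then have "m \<le> cmod (1 - cnj (f 0) * f z)"
    using norm_triangle_ineq2[of 1 "cnj (f 0) * f z"] by (simp add: m_def)
  then have "m\<^sup>2 * (1 - (cmod z)\<^sup>2) \<le> (cmod (1 - cnj (f 0) * f z))\<^sup>2 * (1 - (cmod z)\<^sup>2)"
    using m disc_norm_sq_pos[OF z] by (intro mult_right_mono power_mono) auto
  also have "\<dots> \<le> (1 - (cmod (f 0))\<^sup>2) * (1 - (cmod (f z))\<^sup>2)"
    using schwarz_pick_disc[OF f, of 0 z] z by simp
  also have "\<dots> \<le> (2 * m) * (2 * (1 - cmod (f z)))"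
  proof (intro mult_mono)
    have sq: "1 - r\<^sup>2 \<le> 2 * (1 - r)" for r :: real
      using zero_le_power2[of "1 - r"] by (simp add: power2_eq_square algebra_simps)
    show "1 - (cmod (f 0))\<^sup>2 \<le> 2 * m" "1 - (cmod (f z))\<^sup>2 \<le> 2 * (1 - cmod (f z))"
      unfolding m_def by (rule sq)+
  qed (use m disc_norm_sq_pos[OF fz] in auto)
  finally have "m * (m * (1 - (cmod z)\<^sup>2)) \<le> m * (4 * (1 - cmod (f z)))"
    by (simp add: power2_eq_square mult_ac)
  then have "m * (1 - (cmod z)\<^sup>2) \<le> 4 * (1 - cmod (f z))" using m by simp
  moreover have "(cmod z)\<^sup>2 \<le> cmod z" using z by (simp add: power2_eq_square mult_left_le)
  then have "m * (1 - cmod z) \<le> m * (1 - (cmod z)\<^sup>2)" using m by simp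
  ultimately show ?thesis by (simp add: m_def)
qed

text \<open>Julia's lemma: Schwarz-Pick is based at points \<open>a n\<close> tending to
  \<open>x\<close> along which the boundary quotient stays below \<alpha>, and then n tends to
  infinity. On the radius the resulting horodisc inequality becomes a linear bound.\<close>

lemma julia_radial:
  assumes f: "f holomorphic_on unit_disc" "f ` unit_disc \<subseteq> unit_disc"
    and brfp: "boundary_regular_fixed_point f x"
  obtains C where "C > 0" "\<And>r. 0 < r \<Longrightarrow> r < 1 \<Longrightarrow> cmod (f (of_real r * x) - x) \<le> C * (1 - r)"
proof -
  have x: "x \<in> sphere 0 1" and lim: "angular_lim f (nhds x) x"
    and liminf: "Liminf (at x within unit_disc) (\<lambda>z. ereal ((1 - cmod (f z)) / (1 - cmod z))) < \<infinity>"
    using brfp unfolding boundary_regular_fixed_point_def by auto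
  have fd: "f z \<in> unit_disc" if "z \<in> unit_disc" for z using f(2) that by blast
  obtain \<alpha> where "Liminf (at x within unit_disc) (\<lambda>z. ereal ((1 - cmod (f z)) / (1 - cmod z))) < ereal \<alpha>"
    using liminf less_PInf_Ex_of_nat by auto
  then have "\<not> (\<forall>\<^sub>F z in at x within unit_disc. ereal \<alpha> \<le> ereal ((1 - cmod (f z)) / (1 - cmod z)))"
    using Liminf_bounded by (metis not_le)
  then have "\<exists>z\<in>unit_disc. dist z x < \<delta> \<and> (1 - cmod (f z)) / (1 - cmod z) < \<alpha>" if "\<delta> > 0" for \<delta>
    using that unfolding eventually_at by (force simp: not_le)
  then have "\<exists>z\<in>unit_disc. dist z x < 1 / Suc n \<and> (1 - cmod (f z)) / (1 - cmod z) < \<alpha>" for n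
    by simp
  then obtain a where a: "\<And>n. a n \<in> unit_disc" "\<And>n. dist (a n) x < 1 / Suc n"
      "\<And>n. (1 - cmod (f (a n))) / (1 - cmod (a n)) < \<alpha>" by metis
  have "(\<lambda>n. dist (a n) x) \<longlonglongrightarrow> 0"
    by (rule tendsto_sandwich[OF _ _ tendsto_const LIMSEQ_inverse_real_of_nat])
       (use a(2) in \<open>auto intro!: always_eventually less_imp_le simp: inverse_eq_divide\<close>)
  then have ax: "a \<longlonglongrightarrow> x" by (rule tendsto_dist_iff[THEN iffD2])
  have fa: "1 - cmod (f (a n)) < \<alpha> * (1 - cmod (a n))" for n
    using a(1)[of n] a(3)[of n] by (simp add: pos_divide_less_eq)
  have "0 < (1 - cmod (f (a 0))) / (1 - cmod (a 0))"
    using fd[OF a(1)[of 0]] a(1)[of 0] by simp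
  then have \<alpha>: "\<alpha> > 0" using a(3)[of 0] by linarith
  \<comment> \<open>The \<open>a n\<close> may approach \<open>x\<close> tangentially, where the
    angular limit gives no information on \<open>f (a n)\<close>. A subsequential limit
    \<open>y\<close> is used instead; comparing radial limits at the end shows that it is
    \<open>x\<close>.\<close>
  have "seq_compact (cball 0 1 :: complex set)"
    by (simp add: compact_imp_seq_compact)
  moreover have "\<forall>n. f (a n) \<in> cball 0 1"
    using fd[OF a(1)] by (simp add: less_imp_le)
  ultimately obtain y s where y: "y \<in> cball 0 1" and s: "strict_mono s" "((\<lambda>n. f (a n)) \<circ> s) \<longlonglongrightarrow> y"
    by (rule seq_compactE)
  have as: "(\<lambda>n. a (s n)) \<longlonglongrightarrow> x" using LIMSEQ_subseq_LIMSEQ[OF ax s(1)] by (simp add: o_def)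
  have fas: "(\<lambda>n. f (a (s n))) \<longlonglongrightarrow> y" using s(2) by (simp add: o_def)
  have "1 - cmod y \<le> \<alpha> * (1 - cmod x)"
  proof (rule LIMSEQ_le)
    show "(\<lambda>n. 1 - cmod (f (a (s n)))) \<longlonglongrightarrow> 1 - cmod y" by (intro tendsto_intros fas)
    show "(\<lambda>n. \<alpha> * (1 - cmod (a (s n)))) \<longlonglongrightarrow> \<alpha> * (1 - cmod x)" by (intro tendsto_intros as)
  qed (use fa in \<open>auto intro: less_imp_le\<close>)
  then have y1: "cmod y = 1" using x y by simp
  have yy: "cmod (1 - cnj y * w) = cmod (w - y)" for w
    using norm_cross_disc[of y w] y1 by (simp add: power2_eq_iff_nonneg)
  have julia: "(cmod (f z - y))\<^sup>2 * (1 - (cmod z)\<^sup>2) \<le> 2 * \<alpha> * (cmod (1 - cnj x * z))\<^sup>2 * (1 - (cmod (f z))\<^sup>2)"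
    if z: "z \<in> unit_disc" for z
  proof -
    \<comment> \<open>Dividing by 1 - |a n|^2 before the passage to the limit leaves a quotient of
      defects bounded by 2\<alpha>.\<close>
    have "(cmod (1 - cnj (f (a n)) * f z))\<^sup>2 * (1 - (cmod z)\<^sup>2)
        \<le> 2 * \<alpha> * (cmod (1 - cnj (a n) * z))\<^sup>2 * (1 - (cmod (f z))\<^sup>2)" for n
    proof -
      let ?A = "1 - (cmod (a n))\<^sup>2"
      have A: "?A > 0" using disc_norm_sq_pos[OF a(1)] .
      have fz: "1 - (cmod (f z))\<^sup>2 > 0" using disc_norm_sq_pos[OF fd[OF z]] .
      have sq: "1 - r\<^sup>2 \<le> 2 * (1 - r)" for r :: real
        using zero_le_power2[of "1 - r"] by (simp add: power2_eq_square algebra_simps)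
      have "(cmod (a n))\<^sup>2 \<le> cmod (a n)" using a(1)[of n] by (simp add: power2_eq_square mult_left_le)
      then have "\<alpha> * (1 - cmod (a n)) \<le> \<alpha> * ?A" using \<alpha> by simp
      then have "1 - cmod (f (a n)) \<le> \<alpha> * ?A" using less_imp_le[OF fa[of n]] by (rule order_trans[rotated])
      then have fan: "1 - (cmod (f (a n)))\<^sup>2 \<le> 2 * \<alpha> * ?A"
        using sq[of "cmod (f (a n))"] by simp
      have "(cmod (1 - cnj (f (a n)) * f z))\<^sup>2 * (?A * (1 - (cmod z)\<^sup>2))
        \<le> (cmod (1 - cnj (a n) * z))\<^sup>2 * ((1 - (cmod (f (a n)))\<^sup>2) * (1 - (cmod (f z))\<^sup>2))"
        by (rule schwarz_pick_disc[OF f a(1) z])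
      also have "\<dots> \<le> (cmod (1 - cnj (a n) * z))\<^sup>2 * ((2 * \<alpha> * ?A) * (1 - (cmod (f z))\<^sup>2))"
        using fan fz by (intro mult_left_mono mult_right_mono) auto
      finally have "?A * ((cmod (1 - cnj (f (a n)) * f z))\<^sup>2 * (1 - (cmod z)\<^sup>2))
        \<le> ?A * (2 * \<alpha> * (cmod (1 - cnj (a n) * z))\<^sup>2 * (1 - (cmod (f z))\<^sup>2))"
        by (simp only: mult_ac)
      then show ?thesis using A by (simp only: mult_le_cancel_left_pos)
    qed
    then have "(cmod (1 - cnj y * f z))\<^sup>2 * (1 - (cmod z)\<^sup>2)
        \<le> 2 * \<alpha> * (cmod (1 - cnj x * z))\<^sup>2 * (1 - (cmod (f z))\<^sup>2)"
      by (intro LIMSEQ_le[where X = "\<lambda>n. (cmod (1 - cnj (f (a (s n))) * f z))\<^sup>2 * (1 - (cmod z)\<^sup>2)"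
            and Y = "\<lambda>n. 2 * \<alpha> * (cmod (1 - cnj (a (s n)) * z))\<^sup>2 * (1 - (cmod (f z))\<^sup>2)"]
          tendsto_intros fas as) auto
    then show ?thesis by (simp add: yy)
  qed
  have est: "cmod (f (of_real r * x) - y) \<le> 4 * \<alpha> * (1 - r)" if r: "0 < r" "r < 1" for r
  proof -
    define E where "E = cmod (f (of_real r * x) - y)"
    have z: "of_real r * x \<in> unit_disc" and nz: "cmod (of_real r * x) = r"
      using r x by (simp_all add: norm_mult)
    have E0: "E > 0" using fd[OF z] y1 by (auto simp: E_def)
    have "cnj x * (of_real r * x) = of_real r"
      using x complex_norm_square[of x] by (simp add: mult_ac)
    then have "1 - cnj x * (of_real r * x) = of_real (1 - r)" by simp
    then have n1: "cmod (1 - cnj x * (of_real r * x)) = 1 - r"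
      using r by (simp only: norm_of_real)
    have "1 - cmod (f (of_real r * x)) \<le> E"
      using norm_triangle_ineq3[of y "f (of_real r * x)"] y1 by (simp add: E_def norm_minus_commute)
    moreover have "1 - (cmod (f (of_real r * x)))\<^sup>2 \<le> 2 * (1 - cmod (f (of_real r * x)))"
      using zero_le_power2[of "1 - cmod (f (of_real r * x))"] by (simp add: power2_eq_square algebra_simps)
    ultimately have "1 - (cmod (f (of_real r * x)))\<^sup>2 \<le> 2 * E" by simp
    then have "2 * \<alpha> * (1 - r)\<^sup>2 * (1 - (cmod (f (of_real r * x)))\<^sup>2) \<le> 2 * \<alpha> * (1 - r)\<^sup>2 * (2 * E)"
      using \<alpha> by (intro mult_left_mono) auto
    moreover have "E\<^sup>2 * (1 - r) \<le> E\<^sup>2 * (1 - r\<^sup>2)"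
      using r by (intro mult_left_mono) (auto simp: power2_eq_square mult_left_le)
    moreover have "E\<^sup>2 * (1 - r\<^sup>2) \<le> 2 * \<alpha> * (1 - r)\<^sup>2 * (1 - (cmod (f (of_real r * x)))\<^sup>2)"
      using julia[OF z] by (simp add: n1 nz E_def)
    ultimately have "(E * (1 - r)) * E \<le> (E * (1 - r)) * (4 * \<alpha> * (1 - r))"
      by (simp add: power2_eq_square mult_ac)
    moreover have "E * (1 - r) > 0" using E0 r by simp
    ultimately show ?thesis unfolding E_def[symmetric] by (simp only: mult_le_cancel_left_pos)
  qed
  have "((\<lambda>r. f (of_real r * x) - y) \<longlongrightarrow> 0) (at_left 1)"
  proof (rule Lim_null_comparison)
    show "\<forall>\<^sub>F r in at_left 1. norm (f (of_real r * x) - y) \<le> 4 * \<alpha> * (1 - r)"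
      using eventually_at_left_real[of 0 "1::real"] by (rule eventually_mono) (use est in auto)
    show "((\<lambda>r. 4 * \<alpha> * (1 - r)) \<longlongrightarrow> 0) (at_left 1)" by (auto intro!: tendsto_eq_intros)
  qed
  then have "((\<lambda>r. f (of_real r * x)) \<longlongrightarrow> y) (at_left 1)" by (simp add: LIM_zero_iff)
  moreover have "((\<lambda>r. f (of_real r * x)) \<longlongrightarrow> x) (at_left 1)" by (rule angular_lim_radial[OF lim x])
  ultimately have "y = x" by (intro tendsto_unique[OF _ ]) auto
  then show thesis using est \<alpha> that[of "4 * \<alpha>"] by simp
qed

section \<open>The reciprocal of the generator and the Koenigs function\<close>

text \<open>At a zero of \<open>p\<close> its real part attains the minimum 0, so \<open>p\<close>,
  and with it \<open>G\<close>, would vanish identically.\<close>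

lemma berkson_porta_reciprocal:
  assumes p: "p holomorphic_on unit_disc" "\<And>z. z \<in> unit_disc \<Longrightarrow> Re (p z) \<ge> 0"
    and G: "\<And>z. z \<in> unit_disc \<Longrightarrow> G z = (z - \<tau>) * (cnj \<tau> * z - 1) * p z"
    and ne: "\<exists>z\<in>unit_disc. G z \<noteq> 0"
  shows "z \<in> unit_disc \<Longrightarrow> p z \<noteq> 0"
    and "(\<lambda>z. 1 / p z) holomorphic_on unit_disc"
    and "z \<in> unit_disc \<Longrightarrow> Re (1 / p z) \<ge> 0"
proof -
  show p0: "p z \<noteq> 0" if z: "z \<in> unit_disc" for z
  proof
    assume "p z = 0"
    then have "p w = 0" if "w \<in> unit_disc" for w
      using nonneg_Re_eq_constant[OF p z _ that] by simp
    then show False using ne G by auto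
  qed
  show "(\<lambda>z. 1 / p z) holomorphic_on unit_disc"
    using p0 by (intro holomorphic_intros p(1)) auto
  show "Re (1 / p z) \<ge> 0" if "z \<in> unit_disc"
    using p(2)[OF that] by (simp add: Re_complex_div_ge_0)
qed

text \<open>As |x| = 1, the quadratic factor at \<open>x\<close> equals -x |x - \<tau>|^2; the
  factor \<open>x\<close> cancels and the limit is real.\<close>

lemma reciprocal_generator_angular_lim:
  assumes x: "x \<in> sphere 0 1" and \<tau>: "\<tau> \<noteq> x"
    and G: "\<And>z. z \<in> unit_disc \<Longrightarrow> G z = (z - \<tau>) * (cnj \<tau> * z - 1) / q z"
    and q: "angular_lim (\<lambda>z. (z - x) * q z) (nhds (- (2 * of_real c * x))) x"
  shows "angular_lim (\<lambda>z. (z - x) / G z) (nhds (of_real (2 * c / (cmod (x - \<tau>))\<^sup>2))) x"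
  unfolding angular_lim_def
proof (intro allI impI)
  fix R :: real assume R: "R > 1"
  have xx: "x * cnj x = 1" using x complex_norm_square[of x] by simp
  have x0: "x \<noteq> 0" using x by auto
  have K: "complex_of_real ((cmod (x - \<tau>))\<^sup>2) = (x - \<tau>) * cnj (x - \<tau>)"
    by (simp only: complex_norm_square)
  have "x * ((x - \<tau>) * cnj (x - \<tau>)) = (x - \<tau>) * (x * cnj x - cnj \<tau> * x)"
    by (simp add: algebra_simps)
  then have den: "(x - \<tau>) * (cnj \<tau> * x - 1) = - (x * of_real ((cmod (x - \<tau>))\<^sup>2))"
    unfolding K xx by (simp add: algebra_simps)
  have n0: "complex_of_real ((cmod (x - \<tau>))\<^sup>2) \<noteq> 0" using \<tau> by simp
  have "((\<lambda>z. (z - x) * q z / ((z - \<tau>) * (cnj \<tau> * z - 1))) \<longlongrightarrow>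
      - (2 * of_real c * x) / ((x - \<tau>) * (cnj \<tau> * x - 1))) (at x within stolz_angle x R)"
    using q R n0 x0 unfolding angular_lim_def den[symmetric]
    by (intro tendsto_intros) (auto simp: den)
  also have "- (2 * of_real c * x) / ((x - \<tau>) * (cnj \<tau> * x - 1)) = of_real (2 * c / (cmod (x - \<tau>))\<^sup>2)"
    unfolding den using x0 n0 by simp
  finally show "((\<lambda>z. (z - x) / G z) \<longlongrightarrow> of_real (2 * c / (cmod (x - \<tau>))\<^sup>2)) (at x within stolz_angle x R)"
  proof (rule Lim_transform_eventually)
    show "\<forall>\<^sub>F z in at x within stolz_angle x R.
        (z - x) * q z / ((z - \<tau>) * (cnj \<tau> * z - 1)) = (z - x) / G z"
      using eventually_mem_within by eventually_elim (simp add: stolz_angle_def G)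
  qed
qed

lemma eventually_stolz_ball:
  assumes "e > 0"
  shows "\<forall>\<^sub>F z in at x within stolz_angle x R. z \<in> unit_disc \<inter> ball x e"
  unfolding eventually_at using assms by (intro exI[of _ e]) (auto simp: stolz_angle_def dist_commute)

lemma angular_lim_cong:
  assumes "e > 0" "\<And>z. z \<in> unit_disc \<inter> ball x e \<Longrightarrow> f z = g z"
  shows "angular_lim f F x \<longleftrightarrow> angular_lim g F x"
proof -
  have "\<forall>\<^sub>F z in at x within stolz_angle x R. f z = g z" for R
    using eventually_stolz_ball[OF assms(1)] by (rule eventually_mono) (rule assms(2))
  then show ?thesis
    unfolding angular_lim_def using filterlim_cong[OF refl refl] by blast
qed

text \<open>Near \<open>x\<close> the two normalisations of the Koenigs function are treated alike: \<open>g\<close> is \<open>h\<close> itself or a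
  branch of its logarithm, and in both cases \<open>g' = \<kappa> / G\<close>.\<close>

lemma koenigs_local_primitive:
  assumes k: "koenigs_function G \<tau> h" and x: "x \<in> sphere 0 1" "x \<noteq> \<tau>"
    and G0: "\<And>z. z \<in> unit_disc \<Longrightarrow> z \<noteq> \<tau> \<Longrightarrow> G z \<noteq> 0"
  defines "\<kappa> \<equiv> if \<tau> \<in> unit_disc then deriv G \<tau> else 1"
  obtains e g where "e > 0" "g holomorphic_on unit_disc \<inter> ball x e"
    "\<And>z. z \<in> unit_disc \<inter> ball x e \<Longrightarrow> deriv g z = \<kappa> / G z"
    "\<And>z. z \<in> unit_disc \<inter> ball x e \<Longrightarrow> G z \<noteq> 0"
    "\<And>z. z \<in> unit_disc \<inter> ball x e \<Longrightarrow> if \<tau> \<in> unit_disc then exp (g z) = h z else g z = h z"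
proof -
  \<comment> \<open>This radius keeps \<tau>, the only possible zero of \<open>G\<close> and of the
    elliptic \<open>h\<close>, outside the ball; \<open>?S\<close> is convex, so a logarithm of
    \<open>h\<close> exists on it.\<close>
  define e where "e = dist x \<tau>"
  let ?S = "unit_disc \<inter> ball x e"
  have e: "e > 0" using x by (simp add: e_def)
  have S: "open ?S" "convex ?S" by (auto intro: convex_Int)
  have GS: "G z \<noteq> 0" if "z \<in> ?S" for z using G0[of z] that by (auto simp: e_def)
  have hol: "h holomorphic_on ?S" and inj: "inj_on h unit_disc"
    using k unfolding koenigs_function_def by (auto intro: holomorphic_on_subset)
  show thesis
  proof (cases "\<tau> \<in> unit_disc")
    case False
    then have "deriv h z = 1 / G z" if "z \<in> ?S" for z
      using k GS[OF that] that unfolding koenigs_function_def by (simp add: eq_divide_eq)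
    then show thesis using that[OF e hol] GS False by (simp add: \<kappa>_def)
  next
    case True
    have h\<tau>: "h \<tau> = 0" and dh: "\<And>z. z \<in> unit_disc \<Longrightarrow> deriv h z * G z = deriv G \<tau> * h z"
      using k True unfolding koenigs_function_def by auto
    have h0: "h z \<noteq> 0" if "z \<in> ?S" for z
    proof
      assume "h z = 0"
      then have "z = \<tau>" using inj_onD[OF inj, of z \<tau>] h\<tau> that True by simp
      then show False using that by (simp add: e_def)
    qed
    have "\<forall>\<^sub>F r in at_left 1. of_real r * x \<in> ?S \<and> 0 < r \<and> r < (1::real)"
      by (rule eventually_at_left_disc[OF x(1) e])
    then obtain r :: real where "of_real r * x \<in> ?S"
      using eventually_happens'[OF trivial_limit_at_left_real] by blast
    then obtain g where g: "g holomorphic_on ?S" "\<And>z. z \<in> ?S \<Longrightarrow> exp (g z) = h z"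
      using holomorphic_logarithm_exists[OF S(2,1) hol h0] by blast
    have "deriv g z = deriv G \<tau> / G z" if z: "z \<in> ?S" for z
    proof -
      have "((\<lambda>w. exp (g w)) has_field_derivative exp (g z) * deriv g z) (at z)"
        using holomorphic_derivI[OF g(1) S(1) z] by (auto intro!: derivative_eq_intros)
      then have "(h has_field_derivative exp (g z) * deriv g z) (at z)"
        by (rule has_field_derivative_transform_within_open[OF _ S(1) z g(2)])
      then have "deriv h z = h z * deriv g z"
        using g(2)[OF z] by (simp add: DERIV_imp_deriv)
      then have "h z * (deriv g z * G z) = h z * deriv G \<tau>"
        using dh[of z] z by (simp add: mult_ac)
      then show ?thesis using h0[OF z] GS[OF z] by (simp add: eq_divide_eq)
    qed
    then show thesis using that[OF e g(1)] GS g(2) True by (simp add: \<kappa>_def)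
  qed
qed

text \<open>By Julia's lemma and the Schwarz lemma, \<open>r x\<close> and \<open>f (r x)\<close> satisfy the hypotheses of
  \<open>two_point_estimate\<close> with \<open>\<delta>\<close> proportional to \<open>1 - r\<close>; since the limit is \<open>0\<close>, its \<open>M\<close> can be
  taken arbitrarily small.\<close>

lemma boundary_fixed_displacement:
  assumes x: "x \<in> sphere 0 1" and e: "e > 0" and g: "g holomorphic_on unit_disc \<inter> ball x e"
    and lim: "angular_lim (\<lambda>z. (z - x) * deriv g z) (nhds 0) x"
    and f: "f holomorphic_on unit_disc" "f ` unit_disc \<subseteq> unit_disc"
    and brfp: "boundary_regular_fixed_point f x"
  shows "((\<lambda>r. g (f (of_real r * x)) - g (of_real r * x)) \<longlongrightarrow> 0) (at_left 1)"
    and "\<forall>\<^sub>F r in at_left 1. f (of_real r * x) \<in> unit_disc \<inter> ball x e"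
proof -
  obtain C where C: "C > 0" "\<And>r. 0 < r \<Longrightarrow> r < 1 \<Longrightarrow> cmod (f (of_real r * x) - x) \<le> C * (1 - r)"
    using julia_radial[OF f brfp] by blast
  have fd: "f z \<in> unit_disc" if "z \<in> unit_disc" for z using f(2) that by blast
  define c0 where "c0 = (1 - cmod (f 0)) / 4"
  have "cmod (f 0) < 1" using fd[of 0] by simp
  then have c0: "c0 > 0" by (simp add: c0_def)
  have "(1 - y) / 4 \<le> 1" if "0 \<le> y" for y :: real using that by simp
  then have c1: "c0 \<le> 1" by (simp only: c0_def norm_ge_zero)
  \<comment> \<open>For \<delta> = c0 (1 - r) this makes R\<delta> dominate both C (1 - r), Julia's
    bound for \<open>f (r x)\<close>, and 1 - r, the distance of \<open>r x\<close> from
    \<open>x\<close>.\<close>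
  define R where "R = max 1 C / c0"
  have R: "R \<ge> 1" using c0 c1 by (simp add: R_def pos_le_divide_eq)
  have Rc: "1 \<le> R * c0" "C \<le> R * c0" using c0 by (auto simp: R_def)
  have ev: "\<forall>\<^sub>F r in at_left (1::real). r \<in> {0<..<1} \<and> 1 - r < \<epsilon>" if "\<epsilon> > 0" for \<epsilon>
  proof -
    have "\<forall>\<^sub>F r in at_left 1. r \<in> {max 0 (1 - \<epsilon>)<..<1}"
      using that by (intro eventually_at_left_real) auto
    then show ?thesis by eventually_elim auto
  qed
  show "((\<lambda>r. g (f (of_real r * x)) - g (of_real r * x)) \<longlongrightarrow> 0) (at_left 1)"
  proof (rule tendstoI)
    fix \<epsilon> :: real assume \<epsilon>: "\<epsilon> > 0"
    \<comment> \<open>Then 2RM = \<epsilon>/2.\<close>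
    define M where "M = \<epsilon> / (4 * R)"
    have M: "cmod 0 < M" using \<epsilon> R by (simp add: M_def)
    obtain d where d: "d > 0" and two: "\<And>z1 z2 \<delta>. \<lbrakk>0 < \<delta>; \<delta> < d; cmod (z1 - x) \<le> R * \<delta>;
        cmod (z2 - x) \<le> R * \<delta>; \<delta> \<le> 1 - cmod z1; \<delta> \<le> 1 - cmod z2\<rbrakk> \<Longrightarrow> cmod (g z1 - g z2) \<le> 2 * R * M"
      using two_point_estimate[OF x e g lim M R] by blast
    show "\<forall>\<^sub>F r in at_left 1. dist (g (f (of_real r * x)) - g (of_real r * x)) 0 < \<epsilon>"
      using ev[OF d]
    proof eventually_elim
      case (elim r)
      have "of_real r * x - x = - (of_real (1 - r) * x)" by (simp add: algebra_simps)
      then have n: "cmod (of_real r * x - x) = 1 - r" "cmod (of_real r * x) = r"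
        using elim x by (simp_all add: norm_mult del: of_real_diff)
      have le: "c0 * (1 - r) \<le> 1 - r" using c1 elim by (simp add: mult_le_cancel_right1)
      have "cmod (g (f (of_real r * x)) - g (of_real r * x)) \<le> 2 * R * M"
      proof (rule two[of "c0 * (1 - r)"])
        show "0 < c0 * (1 - r)" using c0 elim by simp
        show "c0 * (1 - r) < d" using le_less_trans[OF le] elim by blast
        have "C * (1 - r) \<le> R * c0 * (1 - r)"
          using Rc(2) by (rule mult_right_mono) (use elim in simp)
        moreover have "cmod (f (of_real r * x) - x) \<le> C * (1 - r)" using C(2)[of r] elim by simp
        ultimately show "cmod (f (of_real r * x) - x) \<le> R * (c0 * (1 - r))"
          unfolding mult.assoc by (rule order_trans[rotated])
        have "1 * (1 - r) \<le> R * c0 * (1 - r)"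
          using Rc(1) by (rule mult_right_mono) (use elim in simp)
        then show "cmod (of_real r * x - x) \<le> R * (c0 * (1 - r))"
          by (simp add: n mult.assoc)
        show "c0 * (1 - r) \<le> 1 - cmod (f (of_real r * x))"
          using disc_self_map_distance[OF f, of "of_real r * x"] n elim by (simp add: c0_def)
        show "c0 * (1 - r) \<le> 1 - cmod (of_real r * x)" using le n by simp
      qed
      also have "2 * R * M < \<epsilon>" using \<epsilon> R by (simp add: M_def)
      finally show ?case by simp
    qed
  qed
  have "e / C > 0" using e C by simp
  from ev[OF this] show "\<forall>\<^sub>F r in at_left 1. f (of_real r * x) \<in> unit_disc \<inter> ball x e"
  proof eventually_elim
    case (elim r)
    have "cmod (f (of_real r * x) - x) \<le> C * (1 - r)" using C(2) elim by simp
    also have "\<dots> < e" using elim C(1) by (simp add: pos_less_divide_eq mult.commute)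
    finally have "f (of_real r * x) \<in> ball x e" by (simp add: dist_norm norm_minus_commute)
    moreover have "of_real r * x \<in> unit_disc" using elim x by (simp add: norm_mult)
    ultimately show ?case using fd by blast
  qed
qed

text \<open>Determines the sign of Re G'(\<tau>) from that of Re p(\<tau>).\<close>

lemma generator_at_fixed_point:
  assumes \<tau>: "\<tau> \<in> unit_disc" and p: "p holomorphic_on unit_disc"
    and G: "\<And>z. z \<in> unit_disc \<Longrightarrow> G z = (z - \<tau>) * (cnj \<tau> * z - 1) * p z"
  shows "deriv G \<tau> = - of_real (1 - (cmod \<tau>)\<^sup>2) * p \<tau>"
proof -
  have "((\<lambda>z. (z - \<tau>) * (cnj \<tau> * z - 1) * p z) has_field_derivative (cnj \<tau> * \<tau> - 1) * p \<tau>) (at \<tau>)"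
    using holomorphic_derivI[OF p open_ball \<tau>] by (auto intro!: derivative_eq_intros)
  then have "(G has_field_derivative (cnj \<tau> * \<tau> - 1) * p \<tau>) (at \<tau>)"
    by (rule has_field_derivative_transform_within_open[OF _ open_ball \<tau>]) (simp add: G)
  then have "deriv G \<tau> = (cnj \<tau> * \<tau> - 1) * p \<tau>" by (rule DERIV_imp_deriv)
  then show ?thesis using complex_norm_square[of \<tau>] by (simp add: algebra_simps)
qed

text \<open>For m > 0 the limit of (z - x) / G z can be inverted. For m = 0 the radial quotient
  |G|/(1 - r) tends to infinity, so its liminf is infinite too.\<close>

lemma generator_radial_conditions:
  assumes x: "x \<in> sphere 0 1" and m: "m \<ge> 0" and e: "e > 0"
    and lim: "angular_lim (\<lambda>z. (z - x) / G z) (nhds (of_real m)) x"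
    and G0: "\<And>z. z \<in> unit_disc \<inter> ball x e \<Longrightarrow> G z \<noteq> 0"
  shows "((\<lambda>r. (1 - r) / cmod (G (of_real r * x))) \<longlongrightarrow> m) (at_left 1)"
    and "m > 0 \<Longrightarrow> ((\<lambda>r. cmod (G (of_real r * x)) / (1 - r)) \<longlongrightarrow> 1 / m) (at_left 1)"
    and "Liminf (at_left 1) (\<lambda>r::real. ereal (cmod (G (of_real r * x)) / (1 - r))) < \<infinity> \<longleftrightarrow> m > 0"
    and "boundary_regular_null_point G x \<longleftrightarrow> m > 0"
proof -
  have ev: "\<forall>\<^sub>F r in at_left (1::real). of_real r * x \<in> unit_disc \<inter> ball x e \<and> 0 < r \<and> r < 1"
    by (rule eventually_at_left_disc[OF x e])
  have "((\<lambda>r. cmod ((of_real r * x - x) / G (of_real r * x))) \<longlongrightarrow> cmod (of_real m)) (at_left 1)"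
    by (intro tendsto_norm angular_lim_radial[OF lim x])
  moreover have "\<forall>\<^sub>F r in at_left (1::real).
      cmod ((of_real r * x - x) / G (of_real r * x)) = (1 - r) / cmod (G (of_real r * x))"
    using ev
  proof eventually_elim
    case (elim r)
    have "of_real r * x - x = - (of_real (1 - r) * x)" by (simp add: algebra_simps)
    then have "cmod (of_real r * x - x) = 1 - r"
      using elim x by (simp add: norm_mult del: of_real_diff)
    then show ?case by (simp add: norm_divide)
  qed
  ultimately have "((\<lambda>r. (1 - r) / cmod (G (of_real r * x))) \<longlongrightarrow> cmod (of_real m)) (at_left 1)"
    by (rule Lim_transform_eventually)
  then show r1: "((\<lambda>r. (1 - r) / cmod (G (of_real r * x))) \<longlongrightarrow> m) (at_left 1)"
    using m by simp
  show r2: "((\<lambda>r. cmod (G (of_real r * x)) / (1 - r)) \<longlongrightarrow> 1 / m) (at_left 1)" if "m > 0"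
    using tendsto_inverse[OF r1] that by (simp add: inverse_eq_divide)
  show "Liminf (at_left 1) (\<lambda>r::real. ereal (cmod (G (of_real r * x)) / (1 - r))) < \<infinity> \<longleftrightarrow> m > 0"
  proof (cases "m > 0")
    case True
    have "Liminf (at_left 1) (\<lambda>r::real. ereal (cmod (G (of_real r * x)) / (1 - r))) = ereal (1 / m)"
      using r2[OF True] by (intro lim_imp_Liminf) auto
    then show ?thesis using True by simp
  next
    case False
    then have m0: "m = 0" using m by simp
    have "\<forall>\<^sub>F r in at_left (1::real). (1 - r) / cmod (G (of_real r * x)) > 0"
      using ev by eventually_elim (use G0 in simp)
    then have "filterlim (\<lambda>r. inverse ((1 - r) / cmod (G (of_real r * x)))) at_top (at_left 1)"
      using r1 unfolding m0 by (intro filterlim_inverse_at_top)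
    then have "((\<lambda>r::real. ereal (cmod (G (of_real r * x)) / (1 - r))) \<longlongrightarrow> \<infinity>) (at_left 1)"
      by (simp add: tendsto_PInfty_eq_at_top)
    then have "Liminf (at_left 1) (\<lambda>r::real. ereal (cmod (G (of_real r * x)) / (1 - r))) = \<infinity>"
      by (intro lim_imp_Liminf) auto
    then show ?thesis using False by simp
  qed
  show "boundary_regular_null_point G x \<longleftrightarrow> m > 0"
  proof
    assume "m > 0"
    then have "angular_lim (\<lambda>z. inverse ((z - x) / G z)) (nhds (inverse (of_real m))) x"
      using lim unfolding angular_lim_def by (intro allI impI tendsto_inverse) auto
    then have "angular_lim (\<lambda>z. G z / (z - x)) (nhds (of_real (inverse m))) x" by simp
    then show "boundary_regular_null_point G x"
      using x unfolding boundary_regular_null_point_def by blast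
  next
    assume "boundary_regular_null_point G x"
    then obtain l :: real where l: "angular_lim (\<lambda>z. G z / (z - x)) (nhds (of_real l)) x"
      unfolding boundary_regular_null_point_def by blast
    \<comment> \<open>The two quotients are reciprocal near \<open>x\<close>, so
      \<open>m * l\<close> = 1 and m is not 0.\<close>
    have "((\<lambda>r. (of_real r * x - x) / G (of_real r * x) * (G (of_real r * x) / (of_real r * x - x)))
        \<longlongrightarrow> of_real m * of_real l) (at_left 1)"
      by (intro tendsto_mult angular_lim_radial[OF lim x] angular_lim_radial[OF l x])
    moreover have "\<forall>\<^sub>F r in at_left (1::real).
        (of_real r * x - x) / G (of_real r * x) * (G (of_real r * x) / (of_real r * x - x)) = 1"
      using ev
    proof eventually_elim
      case (elim r)
      then have "of_real r * x - x \<noteq> 0" "G (of_real r * x) \<noteq> 0" using G0 x by auto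
      then show ?case by simp
    qed
    ultimately have "((\<lambda>r::real. 1 :: complex) \<longlongrightarrow> of_real m * of_real l) (at_left 1)"
      by (rule Lim_transform_eventually)
    then have "(1::complex) = of_real m * of_real l"
      by (intro tendsto_unique[OF _ tendsto_const]) auto
    then have "m \<noteq> 0" by auto
    then show "m > 0" using m by simp
  qed
qed

theorem proposition5p4:
  fixes \<phi> :: "real \<Rightarrow> complex \<Rightarrow> complex" and G h :: "complex \<Rightarrow> complex" and \<tau> x :: complex
  assumes "disc_semigroup \<phi>" and "generator_of \<phi> G"
    and "\<exists>z\<in>unit_disc. G z \<noteq> 0"
    and "denjoy_wolff_point G \<tau>"
    and "\<not> elliptic_group \<phi>"
    and "koenigs_function G \<tau> h"
    and "x \<in> sphere 0 1" and "x \<noteq> \<tau>"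
  shows "let
      c1 = (Liminf (at_left 1) (\<lambda>r::real. ereal (cmod (G (of_real r * x)) / (1 - r))) < \<infinity>);
      c2 = boundary_regular_null_point G x;
      c3_some = (\<exists>t>0. boundary_regular_fixed_point (\<phi> t) x);
      c3_any = (\<forall>t>0. boundary_regular_fixed_point (\<phi> t) x);
      c4 = (\<exists>\<rho>>0. koenigs_radial_growth G \<tau> h x \<rho>);
      c5 = (if \<tau> \<in> unit_disc
            then Limsup (at_left 1) (\<lambda>r::real.
                   ereal (cmod (deriv h (of_real r * x)) * (1 - r) / cmod (h (of_real r * x)))) > 0
            else Limsup (at_left 1) (\<lambda>r::real.
                   ereal (cmod (deriv h (of_real r * x)) * (1 - r))) > 0)
    in
      (c1 \<longleftrightarrow> c2) \<and> (c1 \<longleftrightarrow> c3_some) \<and> (c1 \<longleftrightarrow> c3_any) \<and> (c1 \<longleftrightarrow> c4) \<and> (c1 \<longleftrightarrow> c5) \<and>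
      (c1 \<longrightarrow>
        (\<exists>l>0.
          ((\<lambda>r::real. cmod (G (of_real r * x)) / (1 - r)) \<longlongrightarrow> l) (at_left 1) \<and>
          angular_lim (\<lambda>z. cmod (h z)) at_top x \<and>
          (\<forall>\<rho>>0. koenigs_radial_growth G \<tau> h x \<rho> \<longrightarrow> inverse \<rho> = l) \<and>
          (if \<tau> \<in> unit_disc
           then angular_lim (\<lambda>z. deriv h z * (z - x) / h z) (nhds (deriv G \<tau> / of_real l)) x
           else angular_lim (\<lambda>z. deriv h z * (z - x)) (nhds (1 / of_real l)) x)))"
proof -

  \<comment> \<open>Reduction to the angular limit m of (z - x) / G z\<close>
  note \<phi> = assms(1,2) and k = assms(6) and x = assms(7)
  have \<tau>x: "\<tau> \<noteq> x" using assms(8) by simp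
  obtain p where \<tau>: "\<tau> \<in> cball 0 1" and p: "p holomorphic_on unit_disc"
      "\<And>z. z \<in> unit_disc \<Longrightarrow> Re (p z) \<ge> 0"
      and G: "\<And>z. z \<in> unit_disc \<Longrightarrow> G z = (z - \<tau>) * (cnj \<tau> * z - 1) * p z"
    using assms(4) unfolding denjoy_wolff_point_def by blast
  define q where "q = (\<lambda>z. 1 / p z)"
  have p0: "p z \<noteq> 0" if "z \<in> unit_disc" for z
    using that by (rule berkson_porta_reciprocal(1)[OF p G assms(3), rotated -1])
  have q: "q holomorphic_on unit_disc" "\<And>z. z \<in> unit_disc \<Longrightarrow> Re (q z) \<ge> 0"
    unfolding q_def using berkson_porta_reciprocal(2,3)[OF p G assms(3)] by blast+
  have Gq: "G z = (z - \<tau>) * (cnj \<tau> * z - 1) / q z" if "z \<in> unit_disc" for z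
    using G[OF that] by (simp add: q_def)
  obtain c where c: "c \<ge> 0" "\<And>z. z \<in> unit_disc \<Longrightarrow> c * Re ((x + z) / (x - z)) \<le> Re (q z)"
    and qlim: "angular_lim (\<lambda>z. (z - x) * q z) (nhds (- (2 * of_real c * x))) x"
    using julia_wolff_half_plane[OF q x] by blast
  \<comment> \<open>each of the five conditions is equivalent to \<open>m > 0\<close>, and then \<open>l = 1 / m\<close>, \<open>\<rho> = m\<close>\<close>
  define m where "m = 2 * c / (cmod (x - \<tau>))\<^sup>2"
  have m: "m \<ge> 0" using c by (simp add: m_def)
  have mc: "m > 0 \<longleftrightarrow> c > 0" using \<tau>x c(1) by (simp add: m_def zero_less_divide_iff)
  have lim: "angular_lim (\<lambda>z. (z - x) / G z) (nhds (of_real m)) x"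
    unfolding m_def by (rule reciprocal_generator_angular_lim[OF x \<tau>x Gq qlim])
  have G0: "G z \<noteq> 0" if "z \<in> unit_disc" "z \<noteq> \<tau>" for z
    using G[OF that(1)] p0[OF that(1)] that disc_cross_nonzero[OF \<tau> that(1)] by auto
  define \<kappa> where "\<kappa> = (if \<tau> \<in> unit_disc then deriv G \<tau> else 1)"
  have Re\<kappa>: "Re \<kappa> < 0" if \<tau>d: "\<tau> \<in> unit_disc"
  proof -
    \<comment> \<open>The exclusion of elliptic groups enters here: otherwise \<open>p\<close> is an
      imaginary constant and the semigroup rotates the disc about \<tau>.\<close>
    have "Re (p \<tau>) \<noteq> 0"
    proof
      assume 0: "Re (p \<tau>) = 0"
      then have "p z = p \<tau>" if "z \<in> unit_disc" for z
        using nonneg_Re_eq_constant[OF p \<tau>d 0 that] by blast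
      then have "elliptic_group \<phi>"
        using G by (intro elliptic_group_rotation[OF \<phi> \<tau>d _ 0]) simp
      then show False using assms(5) by blast
    qed
    then have "Re (p \<tau>) > 0" using p(2)[OF \<tau>d] by simp
    moreover have "Re \<kappa> = - ((1 - (cmod \<tau>)\<^sup>2) * Re (p \<tau>))"
      using generator_at_fixed_point[OF \<tau>d p(1) G] \<tau>d
      by (simp add: \<kappa>_def del: of_real_diff)
    ultimately show ?thesis using disc_norm_sq_pos[OF \<tau>d] by simp
  qed
  have \<kappa>0: "\<kappa> \<noteq> 0" using Re\<kappa> by (auto simp: \<kappa>_def split: if_splits)
  obtain e g where e: "e > 0" and g: "g holomorphic_on unit_disc \<inter> ball x e"
    and dg: "\<And>z. z \<in> unit_disc \<inter> ball x e \<Longrightarrow> deriv g z = \<kappa> / G z"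
    and GS: "\<And>z. z \<in> unit_disc \<inter> ball x e \<Longrightarrow> G z \<noteq> 0"
    and gh: "\<And>z. z \<in> unit_disc \<inter> ball x e \<Longrightarrow> if \<tau> \<in> unit_disc then exp (g z) = h z else g z = h z"
    using koenigs_local_primitive[OF k x assms(8) G0] unfolding \<kappa>_def by blast
  have h_hol: "h holomorphic_on unit_disc" using k by (simp add: koenigs_function_def)
  have dh: "deriv h z * G z = (if \<tau> \<in> unit_disc then \<kappa> * h z else 1)" if "z \<in> unit_disc" for z
    using k that by (simp add: koenigs_function_def \<kappa>_def)
  have klim: "angular_lim (\<lambda>z. \<kappa> * ((z - x) / G z)) (nhds (\<kappa> * of_real m)) x"
    using lim unfolding angular_lim_def by (intro allI impI tendsto_mult_left) auto
  then have glim: "angular_lim (\<lambda>z. (z - x) * deriv g z) (nhds (\<kappa> * of_real m)) x"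
    by (subst angular_lim_cong[OF e]) (auto simp: dg)
  \<comment> \<open>the quantity in condition (5) is \<open>|Q (r x)| (1 - r)\<close>\<close>
  define Q where "Q = (\<lambda>z. if \<tau> \<in> unit_disc then deriv h z / h z else deriv h z)"
  have Q: "Q z = \<kappa> / G z" if z: "z \<in> unit_disc \<inter> ball x e" for z
  proof -
    have "h z \<noteq> 0" if "\<tau> \<in> unit_disc" using gh[OF z] that by (metis exp_not_eq_zero)
    then show ?thesis using dh[of z] GS[OF z] z
      by (auto simp: Q_def \<kappa>_def divide_simps)
  qed
  have ev: "\<forall>\<^sub>F r in at_left (1::real). of_real r * x \<in> unit_disc \<inter> ball x e \<and> 0 < r \<and> r < 1"
    by (rule eventually_at_left_disc[OF x e])
  note cond = generator_radial_conditions[OF x m e lim GS]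
  have c1: "Liminf (at_left 1) (\<lambda>r::real. ereal (cmod (G (of_real r * x)) / (1 - r))) < \<infinity> \<longleftrightarrow> m > 0"
    by (rule cond(3))
  have c2: "boundary_regular_null_point G x \<longleftrightarrow> m > 0"
    by (rule cond(4))

  \<comment> \<open>Radial growth of the Koenigs function\<close>
  have growth: "koenigs_radial_growth G \<tau> h x m"
  proof (cases "\<tau> \<in> unit_disc")
    case False
    have "((\<lambda>r. Re (g (of_real r * x)) / ln (1 - r)) \<longlongrightarrow> m) (at_left 1)"
      using radial_log_growth[OF x e g glim] False by (simp add: \<kappa>_def)
    moreover have "\<forall>\<^sub>F r in at_left (1::real).
        Re (g (of_real r * x)) / ln (1 - r) = Re (h (of_real r * x)) / ln (1 - r)"
      using ev by eventually_elim (use gh False in simp)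
    ultimately have "((\<lambda>r. Re (h (of_real r * x)) / ln (1 - r)) \<longlongrightarrow> m) (at_left 1)"
      by (rule Lim_transform_eventually)
    then show ?thesis unfolding koenigs_radial_growth_def using False by simp
  next
    case True
    have "((\<lambda>r. Re (g (of_real r * x)) / ln (1 - r) / Re \<kappa>) \<longlongrightarrow> Re (\<kappa> * of_real m) / Re \<kappa>) (at_left 1)"
      using radial_log_growth[OF x e g glim] Re\<kappa>[OF True] by (intro tendsto_divide tendsto_const) auto
    then have "((\<lambda>r. Re (g (of_real r * x)) / ln (1 - r) / Re \<kappa>) \<longlongrightarrow> m) (at_left 1)"
      using Re\<kappa>[OF True] by simp
    moreover have "\<forall>\<^sub>F r in at_left (1::real). Re (g (of_real r * x)) / ln (1 - r) / Re \<kappa>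
        = ln (cmod (h (of_real r * x))) / (Re (deriv G \<tau>) * ln (1 - r))"
      using ev
    proof eventually_elim
      case (elim r)
      then have "exp (g (of_real r * x)) = h (of_real r * x)" using gh True by metis
      then have "cmod (h (of_real r * x)) = exp (Re (g (of_real r * x)))" by (metis norm_exp_eq_Re)
      then show ?case using True by (simp add: \<kappa>_def mult.commute)
    qed
    ultimately have "((\<lambda>r. ln (cmod (h (of_real r * x))) / (Re (deriv G \<tau>) * ln (1 - r))) \<longlongrightarrow> m) (at_left 1)"
      by (rule Lim_transform_eventually)
    then show ?thesis unfolding koenigs_radial_growth_def using True by simp
  qed
  \<comment> \<open>The growth limit exists for every m \<ge> 0 and equals m, so a positive \<rho>
    exists exactly when m > 0.\<close>
  have growth_unique: "\<rho> = m" if "koenigs_radial_growth G \<tau> h x \<rho>" for \<rho>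
    using that growth unfolding koenigs_radial_growth_def
    by (auto split: if_splits intro: tendsto_unique[OF trivial_limit_at_left_real])
  have c4: "(\<exists>\<rho>>0. koenigs_radial_growth G \<tau> h x \<rho>) \<longleftrightarrow> m > 0"
    using growth growth_unique by blast

  \<comment> \<open>Radial size of the derivative of the Koenigs function\<close>
  have "((\<lambda>r. cmod \<kappa> * ((1 - r) / cmod (G (of_real r * x)))) \<longlongrightarrow> cmod \<kappa> * m) (at_left 1)"
    by (intro tendsto_mult_left cond(1))
  moreover have "\<forall>\<^sub>F r in at_left (1::real).
      cmod \<kappa> * ((1 - r) / cmod (G (of_real r * x))) = cmod (Q (of_real r * x)) * (1 - r)"
    using ev by eventually_elim (simp add: Q norm_divide)
  ultimately have "((\<lambda>r. cmod (Q (of_real r * x)) * (1 - r)) \<longlongrightarrow> cmod \<kappa> * m) (at_left 1)"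
    by (rule Lim_transform_eventually)
  then have "Limsup (at_left 1) (\<lambda>r::real. ereal (cmod (Q (of_real r * x)) * (1 - r))) = ereal (cmod \<kappa> * m)"
    by (intro lim_imp_Limsup) auto
  then have "Limsup (at_left 1) (\<lambda>r::real. ereal (cmod (Q (of_real r * x)) * (1 - r))) > 0 \<longleftrightarrow> m > 0"
    using \<kappa>0 m by (simp add: zero_less_mult_iff)
  then have c5: "(if \<tau> \<in> unit_disc
            then Limsup (at_left 1) (\<lambda>r::real.
                   ereal (cmod (deriv h (of_real r * x)) * (1 - r) / cmod (h (of_real r * x)))) > 0
            else Limsup (at_left 1) (\<lambda>r::real.
                   ereal (cmod (deriv h (of_real r * x)) * (1 - r))) > 0) \<longleftrightarrow> m > 0"
    by (cases "\<tau> \<in> unit_disc") (simp_all add: Q_def norm_divide)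

  \<comment> \<open>Boundary regular fixed points of the semigroup\<close>
  have c3_any: "boundary_regular_fixed_point (\<phi> t) x" if "m > 0" "t > 0" for t
  proof (rule boundary_regular_fixed_pointI[OF x])
    show "\<phi> t ` unit_disc \<subseteq> unit_disc" using disc_semigroupD(2)[OF \<phi>(1)] that by simp
    show "exp (- (cmod (x - \<tau>))\<^sup>2 / (2 * c) * t) > 0" by simp
    show "exp (- (cmod (x - \<tau>))\<^sup>2 / (2 * c) * t) * Re ((x + z) / (x - z))
        \<le> Re ((x + \<phi> t z) / (x - \<phi> t z))" if "z \<in> unit_disc" for z
      using flow_cayley_growth[OF \<phi> x \<tau> \<tau>x Gq _ c(2) _ that, of t] \<open>m > 0\<close> \<open>t > 0\<close> mc by simp
  qed
  have c3_some: "m > 0" if t: "t > 0" and brfp: "boundary_regular_fixed_point (\<phi> t) x" for t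
  proof (rule ccontr)
    assume "\<not> m > 0"
    then have "m = 0" using m by simp
    then have "angular_lim (\<lambda>z. (z - x) * deriv g z) (nhds 0) x" using glim by simp
    note disp = boundary_fixed_displacement[OF x e g this
        disc_semigroupD(1,2)[OF \<phi>(1) less_imp_le[OF t]] brfp]
    \<comment> \<open>For \<tau> in the disc, \<open>g\<close> is a logarithm and the flow relation
      fixes its displacement only up to multiples of 2 pi i, so the exponentials are
      compared.\<close>
    have "\<forall>\<^sub>F r in at_left (1::real). if \<tau> \<in> unit_disc
        then exp (g (\<phi> t (of_real r * x)) - g (of_real r * x)) = exp (\<kappa> * of_real t)
        else g (\<phi> t (of_real r * x)) - g (of_real r * x) = of_real t"
      using ev disp(2)
    proof eventually_elim
      case (elim r)
      let ?z = "of_real r * x"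
      have z: "?z \<in> unit_disc" using elim by blast
      show ?case
      proof (cases "\<tau> \<in> unit_disc")
        case True
        then have "exp (g (\<phi> t ?z)) = h (\<phi> t ?z)" "exp (g ?z) = h ?z"
          using gh elim by (metis, metis)
        moreover have "h (\<phi> t ?z) = exp (\<kappa> * of_real t) * h ?z"
          using dh True t z by (intro flow_multiplicative[OF \<phi> h_hol]) auto
        ultimately show ?thesis using True by (simp add: exp_diff) (metis exp_not_eq_zero nonzero_mult_div_cancel_right)
      next
        case False
        then have "g (\<phi> t ?z) = h (\<phi> t ?z)" "g ?z = h ?z" using gh elim by (metis, metis)
        moreover have "h (\<phi> t ?z) = h ?z + of_real t"
          using dh False t z by (intro flow_additive[OF \<phi> h_hol]) auto
        ultimately show ?thesis using False by simp
      qed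
    qed
    note step = this
    show False
    proof (cases "\<tau> \<in> unit_disc")
      case True
      have "((\<lambda>r. exp (g (\<phi> t (of_real r * x)) - g (of_real r * x))) \<longlongrightarrow> exp 0) (at_left 1)"
        by (intro tendsto_exp disp(1))
      moreover have "\<forall>\<^sub>F r in at_left (1::real).
          exp (g (\<phi> t (of_real r * x)) - g (of_real r * x)) = exp (\<kappa> * of_real t)"
        using step True by simp
      ultimately have "((\<lambda>r::real. exp (\<kappa> * of_real t)) \<longlongrightarrow> exp 0) (at_left 1)"
        by (rule Lim_transform_eventually)
      then have "exp (\<kappa> * of_real t) = exp 0"
        by (intro tendsto_unique[OF _ tendsto_const]) auto
      \<comment> \<open>Passing to moduli contradicts \<open>Re \<kappa>\<close> < 0.\<close>
      then have "cmod (exp (\<kappa> * of_real t)) = 1" by simp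
      then have "Re \<kappa> * t = 0" by simp
      then show False using Re\<kappa>[OF True] t by simp
    next
      case False
      then have "\<forall>\<^sub>F r in at_left (1::real). g (\<phi> t (of_real r * x)) - g (of_real r * x) = of_real t"
        using step by simp
      then have "((\<lambda>r::real. complex_of_real t) \<longlongrightarrow> 0) (at_left 1)"
        by (rule Lim_transform_eventually[OF disp(1)])
      then have "complex_of_real t = 0"
        by (intro tendsto_unique[OF _ tendsto_const]) auto
      then show False using t by simp
    qed
  qed

  \<comment> \<open>Angular behaviour of the Koenigs function when m > 0\<close>
  have inf: "angular_lim (\<lambda>z. cmod (h z)) at_top x" if m0: "m > 0"
  proof -
    \<comment> \<open>\<open>angular_growth\<close> requires a limit with negative real part. The
      limit \<kappa> m for \<open>g\<close> has it when \<tau> lies in the disc; on the circle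
      \<kappa> is 1, so -g is taken.\<close>
    obtain f where "angular_lim (\<lambda>z. Re (f z)) at_top x"
      and f: "\<And>z. z \<in> unit_disc \<inter> ball x e \<Longrightarrow> Re (f z) \<le> cmod (h z)"
    proof (cases "\<tau> \<in> unit_disc")
      case True
      then have "angular_lim (\<lambda>z. Re (g z)) at_top x"
        using angular_growth[OF x e g glim] Re\<kappa>[OF True] m0 by (simp add: mult_neg_pos)
      moreover have "Re (g z) \<le> cmod (h z)" if z: "z \<in> unit_disc \<inter> ball x e" for z
      proof -
        have "exp (g z) = h z" using gh[OF z] True by simp
        then have "cmod (h z) = exp (Re (g z))" by (metis norm_exp_eq_Re)
        then show ?thesis using exp_ge_add_one_self[of "Re (g z)"] by linarith
      qed
      ultimately show thesis by (rule that)
    next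
      case False
      have "angular_lim (\<lambda>z. - ((z - x) * deriv g z)) (nhds (- (\<kappa> * of_real m))) x"
        using glim unfolding angular_lim_def by (intro allI impI tendsto_minus) auto
      moreover have "deriv (\<lambda>w. - g w) z = - deriv g z" if "z \<in> unit_disc \<inter> ball x e" for z
      proof -
        have "open (unit_disc \<inter> ball x e)" by auto
        then show ?thesis
          using holomorphic_derivI[OF g _ that] by (intro DERIV_imp_deriv DERIV_minus) blast
      qed
      ultimately have "angular_lim (\<lambda>z. (z - x) * deriv (\<lambda>w. - g w) z) (nhds (- (\<kappa> * of_real m))) x"
        by (subst angular_lim_cong[OF e]) auto
      then have "angular_lim (\<lambda>z. Re (- g z)) at_top x"
        using m0 False by (intro angular_growth[OF x e holomorphic_on_minus[OF g]]) (auto simp: \<kappa>_def)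
      moreover have "Re (- g z) \<le> cmod (h z)" if z: "z \<in> unit_disc \<inter> ball x e" for z
        using gh[OF z] False complex_Re_le_cmod[of "- g z"] by simp
      ultimately show thesis by (rule that)
    qed
    moreover have "\<forall>\<^sub>F z in at x within stolz_angle x R. Re (f z) \<le> cmod (h z)" for R
      using eventually_stolz_ball[OF e] by (rule eventually_mono) (rule f)
    ultimately show ?thesis
      unfolding angular_lim_def by (blast intro: filterlim_at_top_mono)
  qed

  have "angular_lim (\<lambda>z. Q z * (z - x)) (nhds (\<kappa> * of_real m)) x"
    using klim by (subst angular_lim_cong[OF e]) (auto simp: Q)
  then have a: "if \<tau> \<in> unit_disc
           then angular_lim (\<lambda>z. deriv h z * (z - x) / h z) (nhds (deriv G \<tau> / of_real (1 / m))) x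
           else angular_lim (\<lambda>z. deriv h z * (z - x)) (nhds (1 / of_real (1 / m))) x"
    by (cases "\<tau> \<in> unit_disc") (simp_all add: Q_def \<kappa>_def)
  have "\<exists>l>0. ((\<lambda>r::real. cmod (G (of_real r * x)) / (1 - r)) \<longlongrightarrow> l) (at_left 1) \<and>
          angular_lim (\<lambda>z. cmod (h z)) at_top x \<and>
          (\<forall>\<rho>>0. koenigs_radial_growth G \<tau> h x \<rho> \<longrightarrow> inverse \<rho> = l) \<and>
          (if \<tau> \<in> unit_disc
           then angular_lim (\<lambda>z. deriv h z * (z - x) / h z) (nhds (deriv G \<tau> / of_real l)) x
           else angular_lim (\<lambda>z. deriv h z * (z - x)) (nhds (1 / of_real l)) x)" if "m > 0"
    using that cond(2)[OF _ that] inf[OF that] a growth_unique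
    by (intro exI[of _ "1 / m"]) (auto simp: inverse_eq_divide)
  moreover have "(\<exists>t>0. boundary_regular_fixed_point (\<phi> t) x) \<longleftrightarrow> m > 0"
    using c3_any c3_some zero_less_one by blast
  moreover have "(\<forall>t>0. boundary_regular_fixed_point (\<phi> t) x) \<longleftrightarrow> m > 0"
    using c3_any c3_some zero_less_one by blast
  ultimately show ?thesis
    unfolding Let_def c1 c2 c4 c5 by blast
qed

end
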